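(* Let $\mathcal{G}$ be a hereditary graph class (closed under taking induced subgraphs) and let $k\ge 2$. Suppose that the $k$-dimensional Weisfeiler–Leman algorithm distinguishes every two non-isomorphic $2$-connected vertex-colored graphs $(H,\lambda)$ and $(H',\lambda')$ with $H,H'\in\mathcal{G}$. Then the $k$-dimensional Weisfeiler–Leman algorithm distinguishes every two non-isomorphic graphs in $\mathcal{G}$.
   Context: Graphs are finite, simple and undirected; uncolored graphs are treated as monochromatic. A vertex-colored graph is a pair $(G,\lambda)$ with $\lambda\colon V(G)\to\mathcal{C}$. A graph is $k$-connected if it has more than $k$ vertices and removing any fewer than $k$ vertices leaves it connected. For $k\ge2$, the $k$-dimensional Weisfeiler–Leman (WL) algorithm computes a coloring of $V(G)^k$: the initial color of $(v_1,\dots,v_k)$ consists of $\lambda(v_1)$ together with the isomorphism type of the ordered induced subgraph on $(v_1,\dots,v_k)$ (which entries are equal and which adjacent); in each round the new color of a tuple $\bar v$ is the pair of its old color and the multiset, over $w\in V(G)$, of the $k$-tuples whose $i$-th component is the old color of the tuple obtained from $\bar v$ by replacing its $i$-th entry with $w$. Iteration stops when the partition is stable, giving $\chi^k_G$; colors are canonical and comparable across graphs. The algorithm distinguishes two (colored) graphs if some color is attained by different numbers of $k$-tuples in the two graphs. *)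

theory Defs
  imports Main "HOL-Library.Multiset"
begin

text \<open>Finite simple undirected graphs with vertices from nat:
  a pair (V, E) with V finite and E a symmetric irreflexive relation on V.\<close>

type_synonym graph = "nat set \<times> (nat \<times> nat) set"

definition verts :: "graph \<Rightarrow> nat set" where "verts G = fst G"
definition adj :: "graph \<Rightarrow> nat \<Rightarrow> nat \<Rightarrow> bool" where "adj G u v \<longleftrightarrow> (u, v) \<in> snd G"

definition is_graph :: "graph \<Rightarrow> bool" where
  "is_graph G \<longleftrightarrow> finite (verts G) \<and> snd G \<subseteq> verts G \<times> verts G \<and>
     (\<forall>u v. adj G u v \<longrightarrow> adj G v u \<and> u \<noteq> v)"

text \<open>Vertex colourings are functions nat => nat (only values on the vertex set matter).\<close>

definition iso_col :: "graph \<Rightarrow> (nat \<Rightarrow> nat) \<Rightarrow> graph \<Rightarrow> (nat \<Rightarrow> nat) \<Rightarrow> bool" where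
  "iso_col G c H d \<longleftrightarrow> (\<exists>f. bij_betw f (verts G) (verts H) \<and>
      (\<forall>u\<in>verts G. \<forall>v\<in>verts G. adj G u v \<longleftrightarrow> adj H (f u) (f v)) \<and>
      (\<forall>v\<in>verts G. d (f v) = c v))"

definition iso :: "graph \<Rightarrow> graph \<Rightarrow> bool" where
  "iso G H \<longleftrightarrow> iso_col G (\<lambda>_. 0) H (\<lambda>_. 0)"

definition induced :: "graph \<Rightarrow> nat set \<Rightarrow> graph" where
  "induced G S = (S, snd G \<inter> (S \<times> S))"

definition connected_graph :: "graph \<Rightarrow> bool" where
  "connected_graph G \<longleftrightarrow> (\<forall>u\<in>verts G. \<forall>v\<in>verts G. (u, v) \<in> (snd G)\<^sup>*)"

definition k_connected :: "nat \<Rightarrow> graph \<Rightarrow> bool" where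
  "k_connected k G \<longleftrightarrow> card (verts G) > k \<and>
     (\<forall>X \<subseteq> verts G. card X < k \<longrightarrow> connected_graph (induced G (verts G - X)))"

text \<open>A hereditary graph class: a class of graphs closed under isomorphism
  and under taking induced subgraphs.\<close>

definition hereditary_class :: "graph set \<Rightarrow> bool" where
  "hereditary_class \<G> \<longleftrightarrow> (\<forall>G\<in>\<G>. is_graph G) \<and>
     (\<forall>G\<in>\<G>. \<forall>H. is_graph H \<and> iso G H \<longrightarrow> H \<in> \<G>) \<and>
     (\<forall>G\<in>\<G>. \<forall>S \<subseteq> verts G. induced G S \<in> \<G>)"

text \<open>Canonical colours of k-dimensional WL (comparable across graphs).
  Init: colour of first entry together with the ordered atomic type
  (equalities and adjacencies between the entries).
  Ref: old colour together with the multiset over w of the k-tuple of old colours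
  of the tuples obtained by replacing the i-th entry with w.\<close>

datatype wlcol = Init nat "(bool \<times> bool) list list" | Ref wlcol "wlcol list multiset"

definition atp :: "graph \<Rightarrow> nat list \<Rightarrow> (bool \<times> bool) list list" where
  "atp G vs = map (\<lambda>i. map (\<lambda>j. (vs ! i = vs ! j, adj G (vs ! i) (vs ! j))) [0..<length vs])
                  [0..<length vs]"

primrec wl_col :: "nat \<Rightarrow> graph \<Rightarrow> (nat \<Rightarrow> nat) \<Rightarrow> nat \<Rightarrow> nat list \<Rightarrow> wlcol" where
  "wl_col k G c 0 vs = Init (c (hd vs)) (atp G vs)"
| "wl_col k G c (Suc r) vs = Ref (wl_col k G c r vs)
     (image_mset (\<lambda>w. map (\<lambda>i. wl_col k G c r (vs[i := w])) [0..<k]) (mset_set (verts G)))"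

definition tuples :: "nat \<Rightarrow> nat set \<Rightarrow> nat list set" where
  "tuples k V = {vs. length vs = k \<and> set vs \<subseteq> V}"

text \<open>Colour refinement only refines, so the histograms of the stable colourings differ
  iff the histograms differ after some round r.\<close>

definition wl_distinguishes :: "nat \<Rightarrow> graph \<Rightarrow> (nat \<Rightarrow> nat) \<Rightarrow> graph \<Rightarrow> (nat \<Rightarrow> nat) \<Rightarrow> bool" where
  "wl_distinguishes k G c H d \<longleftrightarrow> (\<exists>r x.
     card {vs \<in> tuples k (verts G). wl_col k G c r vs = x} \<noteq>
     card {vs \<in> tuples k (verts H). wl_col k H d r vs = x})"

end

theory Submission
  imports Defs
begin

text \<open>For vertex-coloured graphs, indistinguishability is shown to imply isomorphism, by induction
  on the number of vertices. Equal Weisfeiler--Leman colours in all rounds mean that Duplicator can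
  play forever in the bijective game. Numbers of walks between two vertices are invariant, and
  splitting walks at their first visit to \<open>v\<close> shows that whether \<open>v\<close> separates \<open>u\<close> from \<open>w\<close> depends
  only on the colours of the pairs among \<open>u\<close>, \<open>v\<close>, \<open>w\<close>. Hence connected components, cut vertices and
  the parts of leaf blocks hanging at a cut vertex are all recognised. Such a piece, with its vertices
  coloured by their colour in the whole graph, is a smaller indistinguishable instance, and the
  isomorphisms between pieces are glued: the colour of a cut vertex determines what hangs at it, and
  components are matched by counting vertices. What remains are \<open>2\<close>-connected graphs and graphs with
  at most two vertices.\<close>

section \<open>Weisfeiler--Leman types\<close>

text \<open>Keeping the colours of all rounds avoids naming a stabilization round: types differ
  exactly if some round separates the tuples.\<close>

definition wl_type :: "nat \<Rightarrow> graph \<Rightarrow> (nat \<Rightarrow> nat) \<Rightarrow> nat list \<Rightarrow> nat \<Rightarrow> wlcol" where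
  "wl_type k G c vs = (\<lambda>r. wl_col k G c r vs)"

text \<open>Repeating the second entry embeds pairs into \<open>k\<close>-tuples, so that the
  \<open>k\<close>-ary colouring induces types of pairs, and of vertices when
  \<open>u = v\<close>.\<close>

definition pair_tuple :: "nat \<Rightarrow> nat \<Rightarrow> nat \<Rightarrow> nat list" where
  "pair_tuple k u v = map (\<lambda>l. if l = 0 then u else v) [0..<k]"

text \<open>Used for colour classes, for components and for the pieces hanging at cut vertices. The
  labels \<open>x\<close> range over a whole type, so labels with empty fibres have to be handled as
  well.\<close>

lemma glue_bij_betw:
  assumes "\<And>x. bij_betw (h x) {a \<in> A. f a = x} {b \<in> B. g b = x}"
  shows "bij_betw (\<lambda>a. h (f a) a) A B"
proof -
  have mem: "h (f a) a \<in> B \<and> g (h (f a) a) = f a" if "a \<in> A" for a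
    using bij_betwE[OF assms[of "f a"]] that by auto
  have "inj_on (\<lambda>a. h (f a) a) A"
  proof (rule inj_onI)
    fix a b assume ab: "a \<in> A" "b \<in> A" "h (f a) a = h (f b) b"
    then have "f a = f b" using mem by metis
    with ab show "a = b"
      using bij_betw_imp_inj_on[OF assms[of "f a"]] by (auto simp: inj_on_def)
  qed
  moreover have "b \<in> (\<lambda>a. h (f a) a) ` A" if "b \<in> B" for b
  proof -
    have "b \<in> h (g b) ` {a \<in> A. f a = g b}"
      using bij_betw_imp_surj_on[OF assms[of "g b"]] that by auto
    then show ?thesis by force
  qed
  ultimately show ?thesis using mem by (auto simp: bij_betw_def)
qed

lemma bij_betw_if_card_fibers_eq:
  assumes "finite A" "finite B"
    and "\<And>x. card {a \<in> A. f a = x} = card {b \<in> B. g b = x}"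
  obtains h where "bij_betw h A B" "\<And>a. a \<in> A \<Longrightarrow> g (h a) = f a"
proof -
  have "\<forall>x. \<exists>h. bij_betw h {a \<in> A. f a = x} {b \<in> B. g b = x}"
    using assms by (intro allI finite_same_card_bij) auto
  then obtain h where h: "\<And>x. bij_betw (h x) {a \<in> A. f a = x} {b \<in> B. g b = x}"
    by (auto dest!: choice)
  show ?thesis
  proof
    show "bij_betw (\<lambda>a. h (f a) a) A B" by (rule glue_bij_betw[OF h])
    show "g (h (f a) a) = f a" if "a \<in> A" for a
      using bij_betwE[OF h[of "f a"]] that by auto
  qed
qed

lemma bij_betw_if_image_mset_eq:
  assumes "finite A" "finite B"
    and "image_mset f (mset_set A) = image_mset g (mset_set B)"
  obtains h where "bij_betw h A B" "\<And>a. a \<in> A \<Longrightarrow> g (h a) = f a"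
proof -
  have "f -` {x} \<inter> A = {a \<in> A. f a = x}" "g -` {x} \<inter> B = {b \<in> B. g b = x}" for x
    by auto
  then have "card {a \<in> A. f a = x} = card {b \<in> B. g b = x}" for x
    using arg_cong[OF assms(3), of "\<lambda>M. count M x"] assms(1,2) by (simp add: count_image_mset)
  then show ?thesis using bij_betw_if_card_fibers_eq[OF assms(1,2)] that by blast
qed

section \<open>Tuples, rounds and bisimulation\<close>

lemma finite_tuples: "finite V \<Longrightarrow> finite (tuples k V)"
  using finite_lists_length_eq[of V k] by (simp add: tuples_def conj_commute)

lemma tuples_update: "vs \<in> tuples k V \<Longrightarrow> w \<in> V \<Longrightarrow> vs[i := w] \<in> tuples k V"
  using set_update_subset_insert[of vs i w] by (auto simp: tuples_def)

lemma tuples_nth: "vs \<in> tuples k V \<Longrightarrow> i < k \<Longrightarrow> vs ! i \<in> V"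
  by (auto simp: tuples_def)

lemma pair_tuple_in_tuples: "u \<in> V \<Longrightarrow> v \<in> V \<Longrightarrow> pair_tuple k u v \<in> tuples k V"
  by (auto simp: pair_tuple_def tuples_def)

lemma wl_col_eq_mono:
  assumes "wl_col k G c r vs = wl_col k G' c' r vs'" "s \<le> r"
  shows "wl_col k G c s vs = wl_col k G' c' s vs'"
  using assms(2,1) by (induction r rule: dec_induct) auto

text \<open>Only finitely many pairs of tuples have to be told apart, so one round separates
  everything that is ever separated.\<close>

lemma wl_stable_round:
  assumes "finite (verts G)" "finite (verts G')"
  obtains r where "\<And>vs vs'. vs \<in> tuples k (verts G) \<Longrightarrow> vs' \<in> tuples k (verts G') \<Longrightarrow>
    wl_col k G c r vs = wl_col k G' c' r vs' \<Longrightarrow> wl_type k G c vs = wl_type k G' c' vs'"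
proof -
  define P where "P = tuples k (verts G) \<times> tuples k (verts G')"
  \<comment> \<open>A round separating the pair if there is one; otherwise an arbitrary number,
    which can only enlarge the maximum.\<close>
  define d where "d = (\<lambda>(vs, vs'). SOME r. wl_col k G c r vs \<noteq> wl_col k G' c' r vs')"
  have fin: "finite P" using assms by (simp add: P_def finite_tuples)
  show ?thesis
  proof (rule that[of "Max (d ` P)"])
    fix vs vs' assume vs: "vs \<in> tuples k (verts G)" "vs' \<in> tuples k (verts G')"
      and eq: "wl_col k G c (Max (d ` P)) vs = wl_col k G' c' (Max (d ` P)) vs'"
    have "d (vs, vs') \<le> Max (d ` P)" using fin vs by (auto simp: P_def)
    then have "wl_col k G c (d (vs, vs')) vs = wl_col k G' c' (d (vs, vs')) vs'"
      using eq wl_col_eq_mono by blast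
    moreover have "wl_col k G c (d (vs, vs')) vs \<noteq> wl_col k G' c' (d (vs, vs')) vs'"
      if "wl_col k G c r vs \<noteq> wl_col k G' c' r vs'" for r
      unfolding d_def using someI[of "\<lambda>r. wl_col k G c r vs \<noteq> wl_col k G' c' r vs'", OF that] by simp
    ultimately show "wl_type k G c vs = wl_type k G' c' vs'"
      unfolding wl_type_def by blast
  qed
qed

text \<open>\<open>R\<close> is an invariant that Duplicator maintains in the bijective game. The
  bijection is fixed before \<open>w\<close> and \<open>i\<close> are chosen, since refinement
  collects for each \<open>w\<close> the colours of all \<open>k\<close> replacements
  together.\<close>

lemma wl_type_coinduct:
  assumes "R vs vs'"
    and "\<And>vs vs'. R vs vs' \<Longrightarrow> c (hd vs) = c' (hd vs') \<and> atp G vs = atp G' vs' \<and>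
      (\<exists>\<beta>. bij_betw \<beta> (verts G) (verts G') \<and>
        (\<forall>w\<in>verts G. \<forall>i<k. R (vs[i := w]) (vs'[i := \<beta> w])))"
  shows "wl_type k G c vs = wl_type k G' c' vs'"
proof -
  have "R vs vs' \<Longrightarrow> wl_col k G c r vs = wl_col k G' c' r vs'" for r vs vs'
  proof (induction r arbitrary: vs vs')
    case 0
    then show ?case using assms(2) by auto
  next
    case (Suc r)
    obtain \<beta> where \<beta>: "bij_betw \<beta> (verts G) (verts G')"
      "\<And>w i. w \<in> verts G \<Longrightarrow> i < k \<Longrightarrow> R (vs[i := w]) (vs'[i := \<beta> w])"
      using assms(2)[OF Suc.prems] by blast
    have "mset_set (verts G') = image_mset \<beta> (mset_set (verts G))"
      using \<beta>(1) by (simp add: bij_betw_def image_mset_mset_set)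
    moreover have "image_mset (\<lambda>w. map (\<lambda>i. wl_col k G c r (vs[i := w])) [0..<k]) (mset_set (verts G))
      = image_mset (\<lambda>w. map (\<lambda>i. wl_col k G' c' r (vs'[i := \<beta> w])) [0..<k]) (mset_set (verts G))"
      using \<beta>(2) Suc.IH
      by (cases "finite (verts G)") (auto intro!: image_mset_cong)
    ultimately show ?case using Suc.IH[OF Suc.prems] by (simp add: multiset.map_comp o_def)
  qed
  with assms(1) show ?thesis by (simp add: wl_type_def)
qed

lemma atp_eq_iff:
  assumes "length vs = length vs'"
  shows "atp G vs = atp G' vs' \<longleftrightarrow> (\<forall>i<length vs. \<forall>j<length vs.
    (vs ! i = vs ! j \<longleftrightarrow> vs' ! i = vs' ! j) \<and> (adj G (vs ! i) (vs ! j) \<longleftrightarrow> adj G' (vs' ! i) (vs' ! j)))"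
  using assms by (auto simp: atp_def)

section \<open>The bijective game on a pair of graphs\<close>

locale wl_pair =
  fixes k :: nat and G G' :: graph and c c' :: "nat \<Rightarrow> nat"
  assumes G: "is_graph G" and G': "is_graph G'" and k: "k \<ge> 2"
begin

abbreviation V where "V \<equiv> verts G"
abbreviation V' where "V' \<equiv> verts G'"

lemma fin: "finite V" "finite V'"
  using G G' by (auto simp: is_graph_def)

text \<open>These are the positions from which Duplicator can play forever; \<open>teq_step\<close>
  provides the moves.\<close>

definition teq :: "nat list \<Rightarrow> nat list \<Rightarrow> bool" where
  "teq vs vs' \<longleftrightarrow> vs \<in> tuples k V \<and> vs' \<in> tuples k V' \<and> wl_type k G c vs = wl_type k G' c' vs'"

definition peq :: "nat \<Rightarrow> nat \<Rightarrow> nat \<Rightarrow> nat \<Rightarrow> bool" where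
  "peq u v u' v' \<longleftrightarrow> u \<in> V \<and> v \<in> V \<and> u' \<in> V' \<and> v' \<in> V' \<and>
     wl_type k G c (pair_tuple k u v) = wl_type k G' c' (pair_tuple k u' v')"

lemma teq_length: "teq vs vs' \<Longrightarrow> length vs = k \<and> length vs' = k"
  by (simp add: teq_def tuples_def)

text \<open>Some round \<open>r\<close> separates whatever is ever separated. Agreement in round
  \<open>Suc r\<close> yields a bijection matching the colours of round \<open>r\<close>, and these
  already determine types.\<close>

lemma teq_step:
  assumes "teq vs vs'"
  obtains \<beta> where "bij_betw \<beta> V V'"
    "\<And>w i. w \<in> V \<Longrightarrow> i < k \<Longrightarrow> teq (vs[i := w]) (vs'[i := \<beta> w])"
proof -
  obtain r where r: "\<And>vs vs'. vs \<in> tuples k V \<Longrightarrow> vs' \<in> tuples k V' \<Longrightarrow>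
      wl_col k G c r vs = wl_col k G' c' r vs' \<Longrightarrow> wl_type k G c vs = wl_type k G' c' vs'"
    using wl_stable_round[OF fin] by blast
  have "wl_col k G c (Suc r) vs = wl_col k G' c' (Suc r) vs'"
    using assms unfolding teq_def wl_type_def by metis
  then obtain \<beta> where \<beta>: "bij_betw \<beta> V V'"
    "\<And>w. w \<in> V \<Longrightarrow> map (\<lambda>i. wl_col k G' c' r (vs'[i := \<beta> w])) [0..<k] =
      map (\<lambda>i. wl_col k G c r (vs[i := w])) [0..<k]"
    by (auto elim: bij_betw_if_image_mset_eq[OF fin])
  have "teq (vs[i := w]) (vs'[i := \<beta> w])" if "w \<in> V" "i < k" for w i
  proof -
    have "\<beta> w \<in> V'" using \<beta>(1) that by (auto dest: bij_betwE)
    moreover have "wl_col k G c r (vs[i := w]) = wl_col k G' c' r (vs'[i := \<beta> w])"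
      using \<beta>(2)[OF that(1)] that(2) by simp
    ultimately show ?thesis
      using assms that r[OF tuples_update tuples_update] by (auto simp: teq_def tuples_update)
  qed
  with \<beta>(1) that show ?thesis by blast
qed

lemma teq_init:
  assumes "teq vs vs'"
  shows "c (hd vs) = c' (hd vs')"
    and "i < k \<Longrightarrow> j < k \<Longrightarrow> vs ! i = vs ! j \<longleftrightarrow> vs' ! i = vs' ! j"
    and "i < k \<Longrightarrow> j < k \<Longrightarrow> adj G (vs ! i) (vs ! j) \<longleftrightarrow> adj G' (vs' ! i) (vs' ! j)"
proof -
  have "wl_col k G c 0 vs = wl_col k G' c' 0 vs'"
    using assms unfolding teq_def wl_type_def by metis
  then have *: "c (hd vs) = c' (hd vs')" "atp G vs = atp G' vs'" by auto
  then show "c (hd vs) = c' (hd vs')" by simp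
  from * show "i < k \<Longrightarrow> j < k \<Longrightarrow> vs ! i = vs ! j \<longleftrightarrow> vs' ! i = vs' ! j"
    and "i < k \<Longrightarrow> j < k \<Longrightarrow> adj G (vs ! i) (vs ! j) \<longleftrightarrow> adj G' (vs' ! i) (vs' ! j)"
    using teq_length[OF assms] atp_eq_iff[of vs vs' G G'] by auto
qed

text \<open>Duplicator must answer \<open>vs ! j\<close> by \<open>vs' ! j\<close>: compare equality types after placing it at a
  position \<open>l \<noteq> j\<close>.\<close>

lemma teq_update_nth:
  assumes "teq vs vs'" "i < k" "j < k"
  shows "teq (vs[i := vs ! j]) (vs'[i := vs' ! j])"
proof -
  obtain \<beta> where \<beta>: "\<And>w i. w \<in> V \<Longrightarrow> i < k \<Longrightarrow> teq (vs[i := w]) (vs'[i := \<beta> w])"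
    using teq_step[OF assms(1)] by metis
  have j: "vs ! j \<in> V" using assms by (auto simp: teq_def tuples_nth)
  obtain l where l: "l < k" "l \<noteq> j"
    using k that[of 0] that[of 1] by fastforce
  have "vs'[l := \<beta> (vs ! j)] ! l = vs'[l := \<beta> (vs ! j)] ! j"
    using teq_init(2)[OF \<beta>[OF j l(1)] l(1) assms(3)] l teq_length[OF assms(1)] assms(3) by auto
  then have "\<beta> (vs ! j) = vs' ! j"
    using l teq_length[OF assms(1)] by simp
  with \<beta>[OF j assms(2)] show ?thesis by simp
qed

text \<open>The initial colour records only the vertex colour of the first entry, so entry
  \<open>i\<close> is first copied to position 0.\<close>

lemma teq_color:
  assumes "teq vs vs'" "i < k"
  shows "c (vs ! i) = c' (vs' ! i)"
  using teq_init(1)[OF teq_update_nth[OF assms(1) _ assms(2), of 0]] teq_length[OF assms(1)] k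
  by (simp add: hd_conv_nth flip: length_greater_0_conv)

text \<open>Reindexed tuples form a bisimulation: of the \<open>k\<close> positions, \<open>\<sigma>\<close> uses at most \<open>k - 1\<close>
  for the entries that are kept, so the new entry can be placed at a free one.\<close>

lemma teq_reindex:
  assumes "teq vs vs'" "\<And>l. l < k \<Longrightarrow> \<sigma> l < k"
  shows "teq (map (\<lambda>l. vs ! \<sigma> l) [0..<k]) (map (\<lambda>l. vs' ! \<sigma> l) [0..<k])"
proof -
  define R where "R = (\<lambda>ws ws'. \<exists>vs vs' \<sigma>. teq vs vs' \<and> (\<forall>l<k. \<sigma> l < k) \<and>
     ws = map (\<lambda>l. vs ! \<sigma> l) [0..<k] \<and> ws' = map (\<lambda>l. vs' ! \<sigma> l) [0..<k])"
  have "wl_type k G c (map (\<lambda>l. vs ! \<sigma> l) [0..<k]) = wl_type k G' c' (map (\<lambda>l. vs' ! \<sigma> l) [0..<k])"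
  proof (rule wl_type_coinduct[of R])
    show "R (map (\<lambda>l. vs ! \<sigma> l) [0..<k]) (map (\<lambda>l. vs' ! \<sigma> l) [0..<k])"
      unfolding R_def using assms by blast
  next
    fix ws ws' assume "R ws ws'"
    then obtain vs vs' \<sigma> where *: "teq vs vs'" "\<And>l. l < k \<Longrightarrow> \<sigma> l < k"
      "ws = map (\<lambda>l. vs ! \<sigma> l) [0..<k]" "ws' = map (\<lambda>l. vs' ! \<sigma> l) [0..<k]"
      unfolding R_def by blast
    have "c (hd ws) = c' (hd ws')"
      using * k teq_color[OF *(1), of "\<sigma> 0"] by (simp add: hd_map)
    moreover have "atp G ws = atp G' ws'"
      using * teq_init(2,3)[OF *(1)] by (subst atp_eq_iff) auto
    moreover obtain \<beta> where \<beta>: "bij_betw \<beta> V V'"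
      "\<And>w i. w \<in> V \<Longrightarrow> i < k \<Longrightarrow> teq (vs[i := w]) (vs'[i := \<beta> w])"
      using teq_step[OF *(1)] by metis
    moreover have "R (ws[i := w]) (ws'[i := \<beta> w])" if w: "w \<in> V" "i < k" for w i
    proof -
      have "card (\<sigma> ` ({..<k} - {i})) \<le> card ({..<k} - {i})" by (rule card_image_le) simp
      also have "\<dots> < card {..<k}" using w by simp
      finally have "\<not> {..<k} \<subseteq> \<sigma> ` ({..<k} - {i})"
        by (metis card_mono finite_Diff finite_imageI finite_lessThan not_le)
      then obtain l where l: "l < k" "l \<notin> \<sigma> ` ({..<k} - {i})" by blast
      have upd: "(map (\<lambda>l. us ! \<sigma> l) [0..<k])[i := x] = map (\<lambda>m. us[l := x] ! (\<sigma>(i := l)) m) [0..<k]"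
        if "length us = k" for us :: "nat list" and x
      proof (rule nth_equalityI)
        fix m assume "m < length ((map (\<lambda>l. us ! \<sigma> l) [0..<k])[i := x])"
        then show "(map (\<lambda>l. us ! \<sigma> l) [0..<k])[i := x] ! m =
            map (\<lambda>m. us[l := x] ! (\<sigma>(i := l)) m) [0..<k] ! m"
          using l that by (cases "m = i") (auto simp: nth_list_update)
      qed simp
      show ?thesis unfolding R_def
        using \<beta>(2)[OF w(1) l(1)] upd teq_length[OF *(1)] *(2,3,4) l(1)
        by (intro exI[of _ "vs[l := w]"] exI[of _ "vs'[l := \<beta> w]"] exI[of _ "\<sigma>(i := l)"]) auto
    qed
    ultimately show "c (hd ws) = c' (hd ws') \<and> atp G ws = atp G' ws' \<and>
      (\<exists>\<beta>. bij_betw \<beta> V V' \<and> (\<forall>w\<in>V. \<forall>i<k. R (ws[i := w]) (ws'[i := \<beta> w])))"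
      by blast
  qed
  then show ?thesis
    using assms by (auto simp: teq_def tuples_def)
qed

text \<open>Reindexing by the map that sends 0 to \<open>i\<close> and every other position to
  \<open>j\<close> turns a tuple into the padded pair of these two entries.\<close>

lemma teq_peq:
  assumes "teq vs vs'" "i < k" "j < k"
  shows "peq (vs ! i) (vs ! j) (vs' ! i) (vs' ! j)"
  using teq_reindex[OF assms(1), of "\<lambda>l. if l = 0 then i else j"] assms
    tuples_nth[of vs k V] tuples_nth[of vs' k V']
  by (auto simp: teq_def peq_def pair_tuple_def if_distrib cong: if_cong)

lemma peq_teq: "peq u v u' v' \<Longrightarrow> teq (pair_tuple k u v) (pair_tuple k u' v')"
  by (simp add: peq_def teq_def pair_tuple_in_tuples)

lemma pair_tuple_nth:
  "pair_tuple k u v ! 0 = u" "pair_tuple k u v ! Suc 0 = v" "length (pair_tuple k u v) = k"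
  using k by (auto simp: pair_tuple_def)

lemma k_pos: "0 < k" "Suc 0 < k"
  using k by auto

lemma peq_proj:
  assumes "peq u v u' v'"
  shows "peq v u v' u'" "peq u u u' u'" "peq v v v' v'"
  using teq_peq[OF peq_teq[OF assms] k_pos(2,1)] teq_peq[OF peq_teq[OF assms] k_pos(1,1)]
    teq_peq[OF peq_teq[OF assms] k_pos(2,2)]
  by (simp_all add: pair_tuple_nth)

lemma peq_init:
  assumes "peq u v u' v'"
  shows "c u = c' u'" "u = v \<longleftrightarrow> u' = v'" "adj G u v \<longleftrightarrow> adj G' u' v'"
  using teq_color[OF peq_teq[OF assms] k_pos(1)] teq_init(2,3)[OF peq_teq[OF assms] k_pos]
  by (simp_all add: pair_tuple_nth)

lemma peq_mem: "peq u v u' v' \<Longrightarrow> u \<in> V \<and> v \<in> V \<and> u' \<in> V' \<and> v' \<in> V'"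
  by (simp add: peq_def)

text \<open>Replacing position 1 and reading off the first two positions gives \<open>u\<close>,
  \<open>w\<close>; replacing position 0 gives \<open>w\<close>, \<open>v\<close>. As the same
  bijection serves both, all three pairs among \<open>u\<close>, \<open>v\<close>, \<open>w\<close>
  agree at once.\<close>

lemma peq_step:
  assumes "peq u v u' v'"
  obtains \<beta> where "bij_betw \<beta> V V'" "\<And>w. w \<in> V \<Longrightarrow> peq u w u' (\<beta> w)"
    "\<And>w. w \<in> V \<Longrightarrow> peq w v (\<beta> w) v'"
proof -
  obtain \<beta> where \<beta>: "bij_betw \<beta> V V'" "\<And>w i. w \<in> V \<Longrightarrow> i < k \<Longrightarrow>
      teq ((pair_tuple k u v)[i := w]) ((pair_tuple k u' v')[i := \<beta> w])"
    using teq_step[OF peq_teq[OF assms]] by metis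
  have "peq u w u' (\<beta> w)" "peq w v (\<beta> w) v'" if "w \<in> V" for w
    using teq_peq[OF \<beta>(2)[OF that k_pos(2)] k_pos] teq_peq[OF \<beta>(2)[OF that k_pos(1)] k_pos] k_pos
    by (simp_all add: pair_tuple_nth)
  with \<beta>(1) that show ?thesis by blast
qed

text \<open>Induction on the number \<open>j\<close> of leading entries that are free. Freeing one
  more entry sums over its value, and the bijection of \<open>teq_step\<close> matches the
  summands.\<close>

lemma teq_count_suffix:
  assumes "teq vs vs'" "j \<le> k"
  shows "card {ws \<in> tuples k V. drop j ws = drop j vs \<and> wl_col k G c r ws = x} =
         card {ws \<in> tuples k V'. drop j ws = drop j vs' \<and> wl_col k G' c' r ws = x}"
  using assms
proof (induction j arbitrary: vs vs')
  case 0
  then have "{ws \<in> tuples k V. drop 0 ws = drop 0 vs \<and> wl_col k G c r ws = x} =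
      (if wl_col k G c r vs = x then {vs} else {})"
    "{ws \<in> tuples k V'. drop 0 ws = drop 0 vs' \<and> wl_col k G' c' r ws = x} =
      (if wl_col k G' c' r vs' = x then {vs'} else {})"
    by (auto simp: teq_def)
  moreover have "wl_col k G c r vs = wl_col k G' c' r vs'"
    using 0 unfolding teq_def wl_type_def by metis
  ultimately show ?case by simp
next
  case (Suc j)
  \<comment> \<open>The tuples agreeing with \<open>us\<close> beyond position \<open>j\<close> are
    sorted by their entry at position \<open>j\<close>.\<close>
  have split: "card {ws \<in> tuples k W. drop (Suc j) ws = drop (Suc j) us \<and> Q ws} =
      (\<Sum>w\<in>W. card {ws \<in> tuples k W. drop j ws = drop j (us[j := w]) \<and> Q ws})"
    if "finite W" "us \<in> tuples k W" for W us and Q :: "nat list \<Rightarrow> bool"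
  proof -
    have len: "length us = k" using that by (simp add: tuples_def)
    have *: "drop j ws = drop j (us[j := w]) \<longleftrightarrow> ws ! j = w \<and> drop (Suc j) ws = drop (Suc j) us"
      if "ws \<in> tuples k W" for ws w
    proof -
      have "drop j ws = ws ! j # drop (Suc j) ws"
        using that Suc.prems(2) by (simp add: tuples_def Cons_nth_drop_Suc)
      moreover have "drop j (us[j := w]) = w # drop (Suc j) us"
        using len Suc.prems(2) by (simp add: drop_update_swap flip: Cons_nth_drop_Suc)
      ultimately show ?thesis by simp
    qed
    have "{ws \<in> tuples k W. drop (Suc j) ws = drop (Suc j) us \<and> Q ws} =
      (\<Union>w\<in>W. {ws \<in> tuples k W. drop j ws = drop j (us[j := w]) \<and> Q ws})"
      using * tuples_nth[of _ k W j] Suc.prems(2) by auto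
    moreover have "\<forall>a\<in>W. \<forall>b\<in>W. a \<noteq> b \<longrightarrow>
      {ws \<in> tuples k W. drop j ws = drop j (us[j := a]) \<and> Q ws} \<inter>
      {ws \<in> tuples k W. drop j ws = drop j (us[j := b]) \<and> Q ws} = {}"
    proof (intro ballI impI equals0I)
      fix a b ws assume "a \<noteq> b" and ws: "ws \<in>
        {ws \<in> tuples k W. drop j ws = drop j (us[j := a]) \<and> Q ws} \<inter>
        {ws \<in> tuples k W. drop j ws = drop j (us[j := b]) \<and> Q ws}"
      have "ws ! j = a" using ws *[of ws a] by blast
      moreover have "ws ! j = b" using ws *[of ws b] by blast
      ultimately show False using \<open>a \<noteq> b\<close> by simp
    qed
    then have "card (\<Union>w\<in>W. {ws \<in> tuples k W. drop j ws = drop j (us[j := w]) \<and> Q ws}) =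
      (\<Sum>w\<in>W. card {ws \<in> tuples k W. drop j ws = drop j (us[j := w]) \<and> Q ws})"
      using that finite_tuples[of W k] by (subst card_UN_disjoint) auto
    ultimately show ?thesis by simp
  qed
  obtain \<beta> where \<beta>: "bij_betw \<beta> V V'"
    "\<And>w. w \<in> V \<Longrightarrow> teq (vs[j := w]) (vs'[j := \<beta> w])"
    using teq_step[OF Suc.prems(1)] Suc.prems(2) by (metis Suc_le_lessD)
  have mem: "vs \<in> tuples k V" "vs' \<in> tuples k V'" using Suc.prems(1) by (auto simp: teq_def)
  show ?case
    using Suc.IH[OF \<beta>(2)] Suc.prems(2)
    by (simp add: split[OF fin(1) mem(1)] split[OF fin(2) mem(2)]
        sum.reindex_bij_betw[OF \<beta>(1), symmetric] cong: sum.cong_simp)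
qed

text \<open>For \<open>j = k\<close> the suffix condition is empty, so a single pair of tuples of
  equal type forces equal histograms in every round.\<close>

lemma teq_not_distinguishes:
  assumes "teq vs vs'"
  shows "\<not> wl_distinguishes k G c G' c'"
proof -
  have *: "{ws \<in> tuples k W. drop k ws = drop k us \<and> Q ws} = {ws \<in> tuples k W. Q ws}"
    if "us \<in> tuples k W" for W us and Q :: "nat list \<Rightarrow> bool"
    using that by (auto simp: tuples_def)
  then show ?thesis
    using teq_count_suffix[OF assms order_refl] assms
    by (simp add: wl_distinguishes_def teq_def *)
qed

text \<open>A colour of a stable round that occurs in one graph occurs in the other as well; the
  first entries of two such tuples have equal vertex type.\<close>

lemma not_distinguishes_peq:
  assumes "\<not> wl_distinguishes k G c G' c'" "V \<noteq> {} \<or> V' \<noteq> {}"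
  shows "\<exists>x x'. peq x x x' x'"
proof -
  obtain r where r: "\<And>vs vs'. vs \<in> tuples k V \<Longrightarrow> vs' \<in> tuples k V' \<Longrightarrow>
      wl_col k G c r vs = wl_col k G' c' r vs' \<Longrightarrow> wl_type k G c vs = wl_type k G' c' vs'"
    using wl_stable_round[OF fin] by blast
  have card_eq: "card {vs \<in> tuples k V. wl_col k G c r vs = x} =
      card {vs \<in> tuples k V'. wl_col k G' c' r vs = x}" for x
    using assms(1) unfolding wl_distinguishes_def by blast
  have "tuples k V \<noteq> {} \<or> tuples k V' \<noteq> {}"
    using assms(2) pair_tuple_in_tuples by blast
  have nonempty: "A \<noteq> {} \<and> B \<noteq> {}"
    if "A \<noteq> {} \<or> B \<noteq> {}" "finite A" "finite B" "card A = card B" for A B :: "nat list set"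
    using that by (metis card_0_eq)
  from \<open>tuples k V \<noteq> {} \<or> tuples k V' \<noteq> {}\<close> obtain x where "{vs \<in> tuples k V. wl_col k G c r vs = x} \<noteq> {} \<or>
      {vs \<in> tuples k V'. wl_col k G' c' r vs = x} \<noteq> {}"
    by blast
  then have "{vs \<in> tuples k V. wl_col k G c r vs = x} \<noteq> {} \<and>
      {vs \<in> tuples k V'. wl_col k G' c' r vs = x} \<noteq> {}"
    by (rule nonempty[OF _ _ _ card_eq]) (simp_all add: finite_tuples fin)
  then obtain vs vs' where "vs \<in> tuples k V" "vs' \<in> tuples k V'"
    "wl_col k G c r vs = x" "wl_col k G' c' r vs' = x" by blast
  then have "teq vs vs'" using r[of vs vs'] by (simp add: teq_def)
  then show ?thesis using teq_peq[OF _ k_pos(1,1)] by blast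
qed

end

section \<open>Walks and separating vertices\<close>

text \<open>Walks avoiding \<open>X\<close>, endpoints included.\<close>

primrec walks :: "graph \<Rightarrow> nat set \<Rightarrow> nat \<Rightarrow> nat \<Rightarrow> nat \<Rightarrow> nat" where
  "walks G X 0 u w = (if u = w \<and> u \<notin> X then 1 else 0)"
| "walks G X (Suc n) u w =
     (if u \<in> X then 0 else \<Sum>x\<in>verts G. if adj G u x then walks G X n x w else 0)"

text \<open>Counts the walks of length \<open>n\<close> from \<open>u\<close> that end in
  \<open>v\<close> and do not meet \<open>v\<close> before.\<close>

primrec first_hits :: "graph \<Rightarrow> nat \<Rightarrow> nat \<Rightarrow> nat \<Rightarrow> nat" where
  "first_hits G v 0 u = (if u = v then 1 else 0)"
| "first_hits G v (Suc n) u =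
     (if u = v then 0 else \<Sum>x\<in>verts G. if adj G u x then first_hits G v n x else 0)"

text \<open>The endpoints are constrained separately because the reflexive closure relates every
  number to itself, even inside \<open>X\<close> or outside the graph.\<close>

definition reach :: "graph \<Rightarrow> nat set \<Rightarrow> nat \<Rightarrow> nat \<Rightarrow> bool" where
  "reach G X u w \<longleftrightarrow> u \<in> verts G - X \<and> w \<in> verts G - X \<and>
     (u, w) \<in> (snd (induced G (verts G - X)))\<^sup>*"

text \<open>Says that deleting \<open>s\<close> leaves a disconnected graph, which is the usual
  notion of a cut vertex when \<open>G\<close> is connected.\<close>

definition cut :: "graph \<Rightarrow> nat \<Rightarrow> bool" where
  "cut G s \<longleftrightarrow> s \<in> verts G \<and>
     (\<exists>u\<in>verts G. \<exists>w\<in>verts G. u \<noteq> s \<and> w \<noteq> s \<and> \<not> reach G {s} u w)"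

text \<open>In a connected graph, the vertices hanging at \<open>s\<close> are the non-cut vertices of the leaf
  blocks whose cut vertex is \<open>s\<close>.\<close>

definition hang :: "graph \<Rightarrow> nat \<Rightarrow> nat \<Rightarrow> bool" where
  "hang G w s \<longleftrightarrow> w \<in> verts G \<and> w \<noteq> s \<and> cut G s \<and>
     (\<forall>x\<in>verts G. x \<noteq> s \<and> cut G x \<longrightarrow> \<not> reach G {s} w x)"

text \<open>Split at the first visit to \<open>v\<close>. Hence the number of walks avoiding \<open>v\<close>, a ternary quantity,
  is a function of binary ones.\<close>

lemma walks_split:
  "walks G {} n u w = walks G {v} n u w + (\<Sum>m\<le>n. first_hits G v m u * walks G {} (n - m) v w)"
proof (induction n arbitrary: u)
  case 0
  show ?case by auto
next
  case (Suc n)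
  show ?case
  proof (cases "u = v")
    case True
    \<comment> \<open>The walk starts at \<open>v\<close>, so the term \<open>m = 0\<close> is the
      only contribution.\<close>
    then show ?thesis by (simp only: sum.atMost_Suc_shift) simp
  next
    case False
    have "walks G {} (Suc n) u w = (\<Sum>x\<in>verts G. if adj G u x then walks G {} n x w else 0)"
      by simp
    also have "\<dots> = (\<Sum>x\<in>verts G. (if adj G u x then walks G {v} n x w else 0) +
        (\<Sum>m\<le>n. (if adj G u x then first_hits G v m x else 0) * walks G {} (n - m) v w))"
      by (rule sum.cong) (simp_all add: Suc.IH)
    also have "\<dots> = walks G {v} (Suc n) u w +
        (\<Sum>m\<le>n. first_hits G v (Suc m) u * walks G {} (n - m) v w)"
      using False by (simp add: sum.distrib sum_distrib_right sum.swap[of _ "verts G"])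
    also have "(\<Sum>m\<le>n. first_hits G v (Suc m) u * walks G {} (n - m) v w) =
        (\<Sum>m\<le>Suc n. first_hits G v m u * walks G {} (Suc n - m) v w)"
      using False by (simp only: sum.atMost_Suc_shift) simp
    finally show ?thesis .
  qed
qed

lemma walks_avoiding_target: "w \<in> X \<Longrightarrow> walks G X n u w = 0"
  by (induction n arbitrary: u) (auto intro!: sum.neutral)

section \<open>Reachability and walk counts\<close>

lemma adj_in_verts: "is_graph G \<Longrightarrow> adj G u v \<Longrightarrow> u \<in> verts G \<and> v \<in> verts G"
  by (auto simp: is_graph_def adj_def)

lemma adj_sym: "is_graph G \<Longrightarrow> adj G u v \<Longrightarrow> adj G v u"
  by (auto simp: is_graph_def)

lemma verts_induced [simp]: "verts (induced G S) = S"
  by (simp add: induced_def verts_def)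

lemma adj_induced: "adj (induced G S) u v \<longleftrightarrow> u \<in> S \<and> v \<in> S \<and> adj G u v"
  by (auto simp: induced_def adj_def)

lemma reach_refl: "u \<in> verts G \<Longrightarrow> u \<notin> X \<Longrightarrow> reach G X u u"
  by (simp add: reach_def)

lemma reach_trans: "reach G X u v \<Longrightarrow> reach G X v w \<Longrightarrow> reach G X u w"
  by (auto simp: reach_def)

lemma reach_mem: "reach G X u v \<Longrightarrow> u \<in> verts G \<and> v \<in> verts G \<and> u \<notin> X \<and> v \<notin> X"
  by (auto simp: reach_def)

lemma reach_adj: "is_graph G \<Longrightarrow> adj G u v \<Longrightarrow> u \<notin> X \<Longrightarrow> v \<notin> X \<Longrightarrow> reach G X u v"
  using adj_in_verts[of G u v] by (auto simp: reach_def induced_def adj_def)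

lemma reach_sym:
  assumes "is_graph G" "reach G X u v"
  shows "reach G X v u"
proof -
  have "sym (snd (induced G (verts G - X)))"
    using assms(1) by (auto simp: sym_def induced_def is_graph_def adj_def)
  then show ?thesis
    using assms(2) by (auto simp: reach_def dest: sym_rtrancl[THEN symD])
qed

lemma reach_induct [consumes 1, case_names refl step]:
  assumes "reach G X u w" "P u"
    and "\<And>y z. reach G X u y \<Longrightarrow> P y \<Longrightarrow> adj G y z \<Longrightarrow> z \<in> verts G \<Longrightarrow> z \<notin> X \<Longrightarrow> P z"
  shows "P w"
proof -
  have "(u, w) \<in> (snd (induced G (verts G - X)))\<^sup>*" "u \<in> verts G - X"
    using assms(1) by (auto simp: reach_def)
  then have "reach G X u w \<and> P w"
  proof (induction rule: rtrancl_induct)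
    case base
    then show ?case using assms(2) by (simp add: reach_refl)
  next
    case (step y z)
    then have "adj G y z" "z \<in> verts G" "z \<notin> X" "y \<in> verts G" "y \<notin> X"
      by (auto simp: induced_def adj_def)
    moreover have "reach G X u z"
      using step by (auto simp: reach_def induced_def intro: rtrancl_into_rtrancl)
    ultimately show ?case using step assms(3) by blast
  qed
  then show ?thesis by simp
qed

lemma reach_iff_walks:
  assumes "is_graph G" "u \<in> verts G"
  shows "reach G X u w \<longleftrightarrow> (\<exists>n. walks G X n u w > 0)"
proof
  assume "reach G X u w"
  \<comment> \<open>The relation is reversed because \<open>walks\<close> recurses on the first
    edge: the induction prolongs walks at their start.\<close>
  then have "reach G X w u" using assms reach_sym by blast
  then show "\<exists>n. walks G X n u w > 0"
  proof (induction rule: reach_induct)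
    case refl
    have "w \<notin> X" using \<open>reach G X w u\<close> reach_mem by blast
    then show ?case by (intro exI[of _ 0]) simp
  next
    case (step y z)
    then obtain n where "walks G X n y w > 0" by blast
    moreover have "adj G z y" "y \<in> verts G" "finite (verts G)"
      using adj_sym[OF assms(1) \<open>adj G y z\<close>] reach_mem[OF \<open>reach G X w y\<close>] assms(1) by (simp_all add: is_graph_def)
    ultimately have "(\<Sum>x\<in>verts G. if adj G z x then walks G X n x w else 0) > 0"
      by (intro sum_pos2[of _ y]) simp_all
    then show ?case using step by (intro exI[of _ "Suc n"]) simp
  qed
next
  have "walks G X n u w > 0 \<Longrightarrow> u \<in> verts G \<Longrightarrow> reach G X u w" for n u
  proof (induction n arbitrary: u)
    case 0
    then show ?case by (auto intro: reach_refl split: if_splits)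
  next
    case (Suc n)
    then have "u \<notin> X" by (cases "u \<in> X") simp_all
    moreover have "walks G X (Suc n) u w \<noteq> 0" using Suc.prems(1) by (rule gr_implies_not0)
    ultimately have "(\<Sum>x\<in>verts G. if adj G u x then walks G X n x w else 0) \<noteq> 0"
      by (simp only: walks.simps if_False not_False_eq_True)
    then obtain x where "x \<in> verts G" "(if adj G u x then walks G X n x w else 0) \<noteq> 0"
      by (rule sum.not_neutral_contains_not_neutral)
    then have x: "adj G u x" "reach G X x w"
      using Suc.IH[of x] by (cases "adj G u x", simp_all)+
    then have "x \<notin> X" using reach_mem by blast
    then show ?case
      using reach_trans[OF reach_adj[OF assms(1) x(1) \<open>u \<notin> X\<close>] x(2)] by simp
  qed
  then show "\<exists>n. walks G X n u w > 0 \<Longrightarrow> reach G X u w" using assms(2) by blast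
qed

section \<open>2-connectedness, cut vertices and hanging vertices\<close>

lemma connected_induced_iff:
  "connected_graph (induced G (verts G - X)) \<longleftrightarrow>
     (\<forall>u\<in>verts G - X. \<forall>w\<in>verts G - X. reach G X u w)"
  by (auto simp: connected_graph_def reach_def)

text \<open>A set with fewer than two elements is empty, which expresses connectedness, or a
  singleton, which expresses the absence of a cut vertex.\<close>

lemma two_connected_iff:
  assumes "is_graph G"
  shows "k_connected 2 G \<longleftrightarrow> card (verts G) > 2 \<and>
    (\<forall>u\<in>verts G. \<forall>w\<in>verts G. reach G {} u w) \<and> (\<forall>s. \<not> cut G s)"
proof -
  have fin: "finite (verts G)" using assms by (simp add: is_graph_def)
  let ?C = "\<lambda>X. \<forall>u\<in>verts G - X. \<forall>w\<in>verts G - X. reach G X u w"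
  have "(\<forall>X\<subseteq>verts G. card X < 2 \<longrightarrow> ?C X) \<longleftrightarrow> ?C {} \<and> (\<forall>s\<in>verts G. ?C {s})"
  proof
    assume *: "\<forall>X\<subseteq>verts G. card X < 2 \<longrightarrow> ?C X"
    have "?C {}" using *[rule_format, of "{}"] by simp
    moreover have "?C {s}" if "s \<in> verts G" for s using *[rule_format, of "{s}"] that by simp
    ultimately show "?C {} \<and> (\<forall>s\<in>verts G. ?C {s})" by blast
  next
    assume *: "?C {} \<and> (\<forall>s\<in>verts G. ?C {s})"
    show "\<forall>X\<subseteq>verts G. card X < 2 \<longrightarrow> ?C X"
    proof (intro allI impI)
      fix X assume X: "X \<subseteq> verts G" "card X < 2"
      then have "finite X" using fin finite_subset by blast
      moreover have "card X = 0 \<or> card X = 1" using X by linarith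
      ultimately have "X = {} \<or> (\<exists>s. X = {s})" by (auto simp: card_1_singleton_iff)
      then show "?C X" using * X(1) by (elim disjE exE) (simp_all del: Diff_iff)
    qed
  qed
  then show ?thesis
    unfolding k_connected_def connected_induced_iff cut_def by simp blast
qed

text \<open>If \<open>s\<close> and \<open>t\<close> differ, a walk from \<open>w\<close> can meet
  neither: up to its first visit to one of them it avoids the other, contradicting that
  \<open>w\<close> hangs at the other. But connectedness provides a walk from \<open>w\<close> to
  \<open>s\<close>.\<close>

lemma hang_unique:
  assumes "is_graph G" "\<forall>u\<in>verts G. \<forall>w\<in>verts G. reach G {} u w"
    and "hang G w s" "hang G w t"
  shows "s = t"
proof (rule ccontr)
  assume "s \<noteq> t"
  have h: "s \<in> verts G" "t \<in> verts G" "w \<in> verts G" "w \<noteq> s" "w \<noteq> t"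
    "\<not> reach G {s} w t" "\<not> reach G {t} w s"
    using assms(3,4) \<open>s \<noteq> t\<close> by (auto simp: hang_def cut_def)
  have "reach G {s} w y \<and> reach G {t} w y" if "reach G {} w y" for y
    using that
  proof (induction rule: reach_induct)
    case refl
    show ?case using h reach_refl[of w G "{s}"] reach_refl[of w G "{t}"] by simp
  next
    case (step y z)
    then have y: "y \<noteq> s" "y \<noteq> t" by (auto dest: reach_mem)
    then have "z \<noteq> t" using step h reach_adj[OF assms(1), of y z "{s}"] reach_trans \<open>s \<noteq> t\<close> by blast
    moreover have "z \<noteq> s" using step h y reach_adj[OF assms(1), of y z "{t}"] reach_trans \<open>s \<noteq> t\<close> by blast
    ultimately show ?case
      using step y reach_adj[OF assms(1), of y z "{s}"] reach_adj[OF assms(1), of y z "{t}"]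
      by (meson reach_trans singletonD)
  qed
  moreover have "reach G {} w s" using assms(2) h by blast
  ultimately have "reach G {s} w s" by blast
  then show False by (auto dest: reach_mem)
qed

text \<open>A smallest component left by deleting a cut vertex contains no further cut vertex: deleting
  the latter would leave a still smaller component.\<close>

lemma hang_exists:
  assumes "is_graph G" "\<forall>u\<in>verts G. \<forall>w\<in>verts G. reach G {} u w" "cut G s"
  shows "\<exists>w t. hang G w t"
proof -
  have fin: "finite (verts G)" using assms by (simp add: is_graph_def)
  define Q where "Q = (\<lambda>(w, t). w \<in> verts G \<and> w \<noteq> t \<and> cut G t)"
  define \<mu> where "\<mu> = (\<lambda>(w, t). card {y. reach G {t} w y})"
  obtain w0 where "Q (w0, s)" using assms(3) by (auto simp: Q_def cut_def)
  then obtain wt where wt: "Q wt" "\<And>p. Q p \<Longrightarrow> \<mu> wt \<le> \<mu> p"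
    using exists_least_iff[of "\<lambda>n. \<exists>p. Q p \<and> \<mu> p = n"] by (metis not_less)
  obtain w t where [simp]: "wt = (w, t)" by fastforce
  have w: "w \<in> verts G" "w \<noteq> t" "cut G t" using wt(1) by (auto simp: Q_def)
  have "\<not> reach G {t} w x" if x: "x \<in> verts G" "x \<noteq> t" "cut G x" for x
  proof
    assume wx: "reach G {t} w x"
    \<comment> \<open>Since deleting \<open>x\<close> disconnects the graph, some vertex is cut off
      from \<open>t\<close>. Its component without \<open>x\<close> misses \<open>t\<close> and
      therefore survives the deletion of \<open>t\<close>.\<close>
    obtain p where p: "p \<in> verts G" "p \<noteq> x" "\<not> reach G {x} p t"
      using x(3) unfolding cut_def by (meson assms(1) reach_sym reach_trans)
    have pt: "p \<noteq> t" using p x(2) reach_refl[of p G "{x}"] by auto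
    have stay: "reach G {t} p y" if "reach G {x} p y" for y
      using that
    proof (induction rule: reach_induct)
      case refl
      then show ?case using p pt by (simp add: reach_refl)
    next
      case (step y z)
      then have "reach G {x} p z"
        using reach_adj[OF assms(1), of y z "{x}"] by (meson reach_mem reach_trans)
      then have "z \<noteq> t" using p by blast
      then show ?case
        using step reach_adj[OF assms(1), of y z "{t}"] by (meson reach_mem reach_trans singletonD)
    qed
    \<comment> \<open>Stopping a walk from \<open>p\<close> to \<open>x\<close> just before its
      first arrival gives a neighbour \<open>z\<close> of \<open>x\<close> in the component of
      \<open>p\<close>. So this component joins that of \<open>w\<close> without \<open>t\<close>,
      but lacks \<open>x\<close> and is strictly smaller.\<close>
    have "reach G {x} p y \<or> (\<exists>z. reach G {x} p z \<and> adj G z x)" if "reach G {} p y" for y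
      using that
    proof (induction rule: reach_induct)
      case refl
      then show ?case using p by (simp add: reach_refl)
    next
      case (step y z)
      then show ?case
        using reach_adj[OF assms(1), of y z "{x}"] by (metis reach_mem reach_trans singletonD)
    qed
    moreover have "reach G {} p x" using assms(2) p x by blast
    ultimately obtain z where z: "reach G {x} p z" "adj G z x" by (auto dest: reach_mem)
    then have "z \<noteq> t" using p(3) by blast
    then have "reach G {t} z x" using z(2) x(2) reach_adj[OF assms(1)] by simp
    then have "reach G {t} w p"
      using wx stay[OF z(1)] assms(1) by (meson reach_sym reach_trans)
    then have "{y. reach G {x} p y} \<subseteq> {y. reach G {t} w y}"
      using stay reach_trans by blast
    moreover have "x \<notin> {y. reach G {x} p y}" by (auto dest: reach_mem)
    ultimately have "{y. reach G {x} p y} \<subset> {y. reach G {t} w y}" using wx by blast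
    moreover have "finite {y. reach G {t} w y}"
      using fin by (rule finite_subset[rotated]) (auto dest: reach_mem)
    ultimately have "\<mu> (p, x) < \<mu> wt" by (simp add: \<mu>_def psubset_card_mono)
    moreover have "Q (p, x)" using p x by (simp add: Q_def)
    ultimately show False using wt(2) not_less by blast
  qed
  then show ?thesis using w by (auto simp: hang_def)
qed

text \<open>Hanging at \<open>s\<close> is a property of whole components of the graph without
  \<open>s\<close>.\<close>

lemma hang_adj:
  assumes "is_graph G" "hang G w s" "adj G w y" "y \<noteq> s"
  shows "hang G y s"
proof -
  have "reach G {s} w y" using assms reach_adj[OF assms(1,3), of "{s}"] by (auto simp: hang_def)
  then show ?thesis
    using assms reach_trans[of G "{s}" w y] unfolding hang_def by (meson reach_mem)
qed

text \<open>A cut vertex other than \<open>t\<close> cannot hang at \<open>t\<close>, because it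
  reaches itself.\<close>

lemma hang_not_hang: "hang G w s \<Longrightarrow> \<not> hang G s t"
  using reach_refl[of s G "{t}"] by (auto simp: hang_def cut_def)

section \<open>Properties determined by types of pairs\<close>

context wl_pair
begin

text \<open>The bijection matches the second vertices \<open>x\<close> of the walks: it preserves
  adjacency to \<open>u\<close> and the type of the pair \<open>x\<close>, \<open>w\<close>.\<close>

lemma walks_peq:
  assumes "peq u w u' w'"
  shows "walks G {} n u w = walks G' {} n u' w'"
  using assms
proof (induction n arbitrary: u u')
  case 0
  then show ?case using peq_init(2)[OF 0] by simp
next
  case (Suc n)
  obtain \<beta> where \<beta>: "bij_betw \<beta> V V'" "\<And>x. x \<in> V \<Longrightarrow> peq u x u' (\<beta> x)"
    "\<And>x. x \<in> V \<Longrightarrow> peq x w (\<beta> x) w'"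
    using peq_step[OF Suc.prems] by metis
  have "(\<Sum>x\<in>V. if adj G u x then walks G {} n x w else 0) =
      (\<Sum>x\<in>V. if adj G' u' (\<beta> x) then walks G' {} n (\<beta> x) w' else 0)"
    using Suc.IH[OF \<beta>(3)] peq_init(3)[OF \<beta>(2)] by (intro sum.cong) simp_all
  then show ?case by (simp add: sum.reindex_bij_betw[OF \<beta>(1), symmetric])
qed

text \<open>Taking \<open>w = v\<close> in \<open>walks_split\<close> removes the walks avoiding
  \<open>v\<close>. The term \<open>m = n\<close> is then \<open>first_hits\<close> itself, as there
  is one walk of length 0 at \<open>v\<close>, and all other terms have smaller index.\<close>

lemma first_hits_peq:
  assumes "peq u v u' v'"
  shows "first_hits G v n u = first_hits G' v' n u'"
proof (induction n rule: less_induct)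
  case (less n)
  have vv: "peq v v v' v'" using peq_proj[OF assms] by blast
  have split: "walks H {} n x y = first_hits H y n x +
      (\<Sum>m<n. first_hits H y m x * walks H {} (n - m) y y)" for H x y
    using walks_split[of H n x y y]
    by (simp add: walks_avoiding_target sum.atMost_Suc_shift flip: lessThan_Suc_atMost)
  show ?case
    using split[of G u v] split[of G' u' v'] less walks_peq[OF assms] walks_peq[OF vv] by simp
qed

lemma reach_peq:
  assumes "peq u w u' w'"
  shows "reach G {} u w \<longleftrightarrow> reach G' {} u' w'"
  using walks_peq[OF assms] peq_mem[OF assms] by (simp add: reach_iff_walks G G')

text \<open>In \<open>walks_split\<close> everything except the number of walks avoiding
  \<open>v\<close> agrees, hence this number does too.\<close>

lemma reach_avoiding_peq:
  assumes "peq u w u' w'" "peq u v u' v'" "peq v w v' w'"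
  shows "reach G {v} u w \<longleftrightarrow> reach G' {v'} u' w'"
proof -
  have "walks G {v} n u w = walks G' {v'} n u' w'" for n
    using walks_split[of G n u w v] walks_split[of G' n u' w' v']
      walks_peq[OF assms(1)] walks_peq[OF assms(3)] first_hits_peq[OF assms(2)] by simp
  then show ?thesis using peq_mem[OF assms(1)] by (simp add: reach_iff_walks G G')
qed

text \<open>Transfers one quantified vertex at a time. The predicates may depend on all three pairs
  among \<open>u\<close>, \<open>v\<close>, \<open>w\<close>; the recognition lemmas below are
  instances, nested where two vertices are quantified.\<close>

lemma peq_ex:
  assumes "peq u v u' v'"
    and "\<And>w w'. peq u w u' w' \<Longrightarrow> peq w v w' v' \<Longrightarrow> Q w \<longleftrightarrow> Q' w'"
  shows "(\<exists>w\<in>V. Q w) \<longleftrightarrow> (\<exists>w\<in>V'. Q' w)"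
proof -
  obtain \<beta> where \<beta>: "bij_betw \<beta> V V'" "\<And>x. x \<in> V \<Longrightarrow> peq u x u' (\<beta> x)"
    "\<And>x. x \<in> V \<Longrightarrow> peq x v (\<beta> x) v'"
    using peq_step[OF assms(1)] by metis
  have "(\<exists>w\<in>V. Q w) \<longleftrightarrow> (\<exists>w\<in>V. Q' (\<beta> w))" using assms(2) \<beta>(2,3) by blast
  also have "\<dots> \<longleftrightarrow> (\<exists>w\<in>V'. Q' w)" by (simp flip: bij_betw_imp_surj_on[OF \<beta>(1)])
  finally show ?thesis .
qed

lemma cut_peq:
  assumes "peq s s s' s'"
  shows "cut G s \<longleftrightarrow> cut G' s'"
proof -
  have *: "(\<exists>w\<in>V. u \<noteq> s \<and> w \<noteq> s \<and> \<not> reach G {s} u w) \<longleftrightarrow>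
      (\<exists>w\<in>V'. u' \<noteq> s' \<and> w \<noteq> s' \<and> \<not> reach G' {s'} u' w)" if "peq u s u' s'" for u u'
  proof (rule peq_ex[OF that])
    fix w w' assume w: "peq u w u' w'" "peq w s w' s'"
    show "(u \<noteq> s \<and> w \<noteq> s \<and> \<not> reach G {s} u w) \<longleftrightarrow> (u' \<noteq> s' \<and> w' \<noteq> s' \<and> \<not> reach G' {s'} u' w')"
      using peq_init(2)[OF that] peq_init(2)[OF w(2)]
        reach_avoiding_peq[OF w(1) that peq_proj(1)[OF w(2)]] by simp
  qed
  have "(\<exists>u\<in>V. \<exists>w\<in>V. u \<noteq> s \<and> w \<noteq> s \<and> \<not> reach G {s} u w) \<longleftrightarrow>
      (\<exists>u\<in>V'. \<exists>w\<in>V'. u \<noteq> s' \<and> w \<noteq> s' \<and> \<not> reach G' {s'} u w)"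
    by (rule peq_ex[OF assms]) (rule *)
  then show ?thesis using peq_mem[OF assms] by (simp add: cut_def)
qed

lemma hang_peq:
  assumes "peq w s w' s'"
  shows "hang G w s \<longleftrightarrow> hang G' w' s'"
proof -
  have ex: "(\<exists>x\<in>V. x \<noteq> s \<and> cut G x \<and> reach G {s} w x) \<longleftrightarrow>
      (\<exists>x\<in>V'. x \<noteq> s' \<and> cut G' x \<and> reach G' {s'} w' x)"
  proof (rule peq_ex[OF assms])
    fix x x' assume x: "peq w x w' x'" "peq x s x' s'"
    show "(x \<noteq> s \<and> cut G x \<and> reach G {s} w x) \<longleftrightarrow> (x' \<noteq> s' \<and> cut G' x' \<and> reach G' {s'} w' x')"
      using peq_init(2)[OF x(2)] cut_peq[OF peq_proj(2)[OF x(2)]]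
        reach_avoiding_peq[OF x(1) assms peq_proj(1)[OF x(2)]] by simp
  qed
  \<comment> \<open>The universal condition becomes a negated existential, the form that
    \<open>peq_ex\<close> transfers.\<close>
  have hang_iff: "hang H y t \<longleftrightarrow> y \<in> verts H \<and> y \<noteq> t \<and> cut H t \<and>
      \<not> (\<exists>x\<in>verts H. x \<noteq> t \<and> cut H x \<and> reach H {t} y x)" for H y t
    unfolding hang_def by blast
  show ?thesis
    using peq_mem[OF assms]
    by (simp only: hang_iff ex peq_init(2)[OF assms] cut_peq[OF peq_proj(3)[OF assms]])
qed

lemma hangs_somewhere_peq:
  assumes "peq w w w' w'"
  shows "(\<exists>s\<in>V. hang G w s) \<longleftrightarrow> (\<exists>s\<in>V'. hang G' w' s)"
  by (rule peq_ex[OF assms]) (rule hang_peq)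

lemma hang_together_peq:
  assumes "peq x y x' y'"
  shows "(\<exists>s\<in>V. hang G x s \<and> hang G y s) \<longleftrightarrow> (\<exists>s\<in>V'. hang G' x' s \<and> hang G' y' s)"
proof (rule peq_ex[OF assms])
  fix s s' assume "peq x s x' s'" "peq s y s' y'"
  then show "(hang G x s \<and> hang G y s) \<longleftrightarrow> (hang G' x' s' \<and> hang G' y' s')"
    using hang_peq[of x s x' s'] hang_peq[OF peq_proj(1), of s y s' y'] by simp
qed

lemma adj_attachment_peq:
  assumes "peq w w w' w'"
  shows "(\<exists>s\<in>V. hang G w s \<and> adj G w s) \<longleftrightarrow> (\<exists>s\<in>V'. hang G' w' s \<and> adj G' w' s)"
proof (rule peq_ex[OF assms])
  fix s s' assume "peq w s w' s'"
  then show "(hang G w s \<and> adj G w s) \<longleftrightarrow> (hang G' w' s' \<and> adj G' w' s')"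
    using hang_peq peq_init(3) by simp
qed

section \<open>Type-preserving isomorphisms\<close>

text \<open>Types refer to the whole graphs, not to the pieces. This retains how a piece is attached
  to the rest, which gluing relies on.\<close>

definition piece_iso :: "nat set \<Rightarrow> nat set \<Rightarrow> (nat \<Rightarrow> nat) \<Rightarrow> bool" where
  "piece_iso U U' f \<longleftrightarrow> bij_betw f U U' \<and> (\<forall>x\<in>U. \<forall>y\<in>U. adj G x y \<longleftrightarrow> adj G' (f x) (f y)) \<and>
     (\<forall>x\<in>U. peq x x (f x) (f x))"

text \<open>\<open>P\<close> recognises, from any vertex of \<open>U\<close>, which vertices belong to \<open>U\<close>; so the game can be
  played inside \<open>U\<close>.\<close>

lemma wl_type_induced_eq:
  assumes sub: "U \<subseteq> V" "U' \<subseteq> V'"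
    and P: "\<And>x y x' y'. peq x y x' y' \<Longrightarrow> P x y \<longleftrightarrow> P' x' y'"
    and U: "\<And>x y. x \<in> U \<Longrightarrow> y \<in> V \<Longrightarrow> y \<in> U \<longleftrightarrow> P x y"
    and U': "\<And>x y. x \<in> U' \<Longrightarrow> y \<in> V' \<Longrightarrow> y \<in> U' \<longleftrightarrow> P' x y"
    and x: "peq x x x' x'" "x \<in> U" "x' \<in> U'"
    and d: "\<And>y y'. y \<in> U \<Longrightarrow> y' \<in> U' \<Longrightarrow> peq y y y' y' \<Longrightarrow> d y = d' y'"
  shows "wl_type k (induced G U) d (pair_tuple k x x) = wl_type k (induced G' U') d' (pair_tuple k x' x')"
proof (rule wl_type_coinduct[where R = "\<lambda>vs vs'. teq vs vs' \<and> set vs \<subseteq> U \<and> set vs' \<subseteq> U'"])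
  show "teq (pair_tuple k x x) (pair_tuple k x' x') \<and> set (pair_tuple k x x) \<subseteq> U \<and>
      set (pair_tuple k x' x') \<subseteq> U'"
    using peq_teq[OF x(1)] x(2,3) by (auto simp: pair_tuple_def)
next
  fix vs vs' assume "teq vs vs' \<and> set vs \<subseteq> U \<and> set vs' \<subseteq> U'"
  then have vs: "teq vs vs'" "set vs \<subseteq> U" "set vs' \<subseteq> U'" by auto
  have len: "length vs = k" "length vs' = k" using teq_length[OF vs(1)] by auto
  have nth: "vs ! i \<in> U" "vs' ! i \<in> U'" if "i < k" for i
    using subsetD[OF vs(2) nth_mem] subsetD[OF vs(3) nth_mem] len that by simp_all
  have "d (vs ! 0) = d' (vs' ! 0)"
    by (rule d[OF nth teq_peq[OF vs(1)]]) (simp_all add: k_pos)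
  then have "d (hd vs) = d' (hd vs')"
    using len k_pos by (simp add: hd_conv_nth flip: length_greater_0_conv)
  moreover have "atp (induced G U) vs = atp (induced G' U') vs'"
    using len nth teq_init(2,3)[OF vs(1)] by (subst atp_eq_iff) (simp_all add: adj_induced)
  moreover obtain \<beta> where \<beta>: "bij_betw \<beta> V V'"
    "\<And>w i. w \<in> V \<Longrightarrow> i < k \<Longrightarrow> teq (vs[i := w]) (vs'[i := \<beta> w])"
    using teq_step[OF vs(1)] by metis
  \<comment> \<open>Entry 0 lies in the piece, so the type of its pair with the new vertex decides
    membership of the latter.\<close>
  have mem: "w \<in> U \<longleftrightarrow> \<beta> w \<in> U'" if w: "w \<in> V" for w
  proof -
    have "peq (vs ! 0) w (vs' ! 0) (\<beta> w)"
      using teq_peq[OF \<beta>(2)[OF w k_pos(2)] k_pos] len k_pos by simp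
    then show ?thesis
      using P U[OF nth(1)[OF k_pos(1)] w] U'[OF nth(2)[OF k_pos(1)], of "\<beta> w"] w bij_betwE[OF \<beta>(1)]
      by simp
  qed
  have "bij_betw \<beta> U U'"
  proof (rule bij_betw_subset[OF \<beta>(1) sub(1)])
    show "\<beta> ` U = U'"
    proof (intro equalityI subsetI)
      show "y \<in> U'" if "y \<in> \<beta> ` U" for y using that mem sub(1) by blast
      show "y \<in> \<beta> ` U" if y: "y \<in> U'" for y
      proof -
        have "y \<in> \<beta> ` V" using y sub(2) bij_betw_imp_surj_on[OF \<beta>(1)] by blast
        with y mem show ?thesis by blast
      qed
    qed
  qed
  moreover have "teq (vs[i := w]) (vs'[i := \<beta> w]) \<and> set (vs[i := w]) \<subseteq> U \<and>
      set (vs'[i := \<beta> w]) \<subseteq> U'" if "w \<in> U" "i < k" for w i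
  proof -
    have w: "w \<in> V" using that sub by blast
    then have "\<beta> w \<in> U'" using mem that by simp
    then show ?thesis
      using \<beta>(2)[OF w that(2)] that(1) vs(2,3) by (simp add: set_update_subsetI)
  qed
  ultimately show "d (hd vs) = d' (hd vs') \<and> atp (induced G U) vs = atp (induced G' U') vs' \<and>
      (\<exists>\<beta>. bij_betw \<beta> (verts (induced G U)) (verts (induced G' U')) \<and>
        (\<forall>w\<in>verts (induced G U). \<forall>i<k. teq (vs[i := w]) (vs'[i := \<beta> w]) \<and>
          set (vs[i := w]) \<subseteq> U \<and> set (vs'[i := \<beta> w]) \<subseteq> U'))"
    unfolding verts_induced by blast
qed

end

text \<open>\<open>smaller\<close> is the induction hypothesis. Only \<open>U\<close> has to be a
  proper subset, because the induction is on the number of vertices of \<open>G\<close>.\<close>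

locale wl_pair_step = wl_pair +
  assumes smaller: "\<And>U U' d d' x x'. U \<subset> V \<Longrightarrow> U' \<subseteq> V' \<Longrightarrow> x \<in> U \<Longrightarrow> x' \<in> U' \<Longrightarrow>
    wl_type k (induced G U) d (pair_tuple k x x) =
      wl_type k (induced G' U') d' (pair_tuple k x' x') \<Longrightarrow>
    iso_col (induced G U) d (induced G' U') d'"
begin

text \<open>The vertex types of \<open>G\<close> and \<open>G'\<close>, coded as numbers, serve as colours of the pieces.\<close>

lemma piece_iso_exists:
  assumes sub: "U \<subset> V" "U' \<subseteq> V'"
    and P: "\<And>x y x' y'. peq x y x' y' \<Longrightarrow> P x y \<longleftrightarrow> P' x' y'"
    and U: "\<And>x y. x \<in> U \<Longrightarrow> y \<in> V \<Longrightarrow> y \<in> U \<longleftrightarrow> P x y"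
    and U': "\<And>x y. x \<in> U' \<Longrightarrow> y \<in> V' \<Longrightarrow> y \<in> U' \<longleftrightarrow> P' x y"
    and x: "peq x x x' x'" "x \<in> U" "x' \<in> U'"
  shows "\<exists>f. piece_iso U U' f"
proof -
  define t where "t = (\<lambda>y. wl_type k G c (pair_tuple k y y))"
  define t' where "t' = (\<lambda>y. wl_type k G' c' (pair_tuple k y y))"
  have "finite (t ` V \<union> t' ` V')" using fin by simp
  \<comment> \<open>One coding for both graphs, so that equal colours mean equal types across
    them.\<close>
  then obtain e :: "(nat \<Rightarrow> wlcol) \<Rightarrow> nat" where e: "inj_on e (t ` V \<union> t' ` V')"
    using finite_imp_inj_to_nat_seg[of "t ` V \<union> t' ` V'"] by blast
  have "iso_col (induced G U) (e \<circ> t) (induced G' U') (e \<circ> t')"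
  proof (rule smaller[OF sub x(2,3)])
    show "wl_type k (induced G U) (e \<circ> t) (pair_tuple k x x) =
        wl_type k (induced G' U') (e \<circ> t') (pair_tuple k x' x')"
    proof (rule wl_type_induced_eq[OF _ sub(2) P U U' x])
      show "U \<subseteq> V" using sub(1) by blast
      show "(e \<circ> t) y = (e \<circ> t') y'" if "peq y y y' y'" for y y'
        using that by (simp add: peq_def t_def t'_def)
    qed
  qed
  then obtain f where f: "bij_betw f U U'"
    "\<forall>y\<in>U. \<forall>z\<in>U. adj (induced G U) y z \<longleftrightarrow> adj (induced G' U') (f y) (f z)"
    "\<forall>y\<in>U. e (t' (f y)) = e (t y)"
    unfolding iso_col_def verts_induced o_def by blast
  have fU: "f y \<in> U'" if "y \<in> U" for y using f(1) that by (auto dest: bij_betwE)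
  have "peq y y (f y) (f y)" if "y \<in> U" for y
  proof -
    have "t' (f y) = t y"
      using f(3) fU[OF that] that sub by (intro inj_onD[OF e]) auto
    then show ?thesis using that fU[OF that] sub by (auto simp: peq_def t_def t'_def)
  qed
  then have "piece_iso U U' f"
    using f fU by (auto simp: piece_iso_def adj_induced)
  then show ?thesis by blast
qed

end

section \<open>Disconnected graphs\<close>

definition component :: "graph \<Rightarrow> nat \<Rightarrow> nat set" where
  "component G x = {y. reach G {} x y}"

lemma component_subset: "component G x \<subseteq> verts G"
  using reach_mem unfolding component_def by blast

lemma component_self: "x \<in> verts G \<Longrightarrow> x \<in> component G x"
  by (simp add: component_def reach_refl)

lemma component_eq:
  assumes "is_graph G" "y \<in> component G x"
  shows "component G y = component G x"
  using assms(2) reach_sym[OF assms(1)] reach_trans[of G "{}"] unfolding component_def by blast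

lemma component_mem_iff:
  assumes "is_graph G"
  shows "y \<in> component G x \<longleftrightarrow> y \<in> verts G \<and> component G y = component G x"
  using component_eq[OF assms, of y x] component_self[of y G] component_subset[of G x] by blast

lemma component_adj: "is_graph G \<Longrightarrow> adj G x y \<Longrightarrow> component G x = component G y"
  using component_eq[of G y x] reach_adj[of G x y "{}"] by (simp add: component_def)

text \<open>Components partition the vertices, so counting vertices, which types control, counts
  components of a common size \<open>m\<close>.\<close>

lemma card_fiber_of_component_label:
  assumes G: "is_graph G"
    and m: "\<And>v. v \<in> verts G \<Longrightarrow> L (component G v) = l \<Longrightarrow> card (component G v) = m"
  shows "card {v \<in> verts G. L (component G v) = l} = m * card {A \<in> component G ` verts G. L A = l}"
proof -
  define F where "F = {A \<in> component G ` verts G. L A = l}"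
  have fin: "finite (verts G)" using G by (simp add: is_graph_def)
  have F: "\<exists>v\<in>verts G. A = component G v \<and> L (component G v) = l" if "A \<in> F" for A
    using that by (auto simp: F_def)
  have Un: "\<Union>F = {v \<in> verts G. L (component G v) = l}"
  proof (intro equalityI subsetI)
    fix y assume "y \<in> \<Union>F"
    then obtain v where v: "v \<in> verts G" "y \<in> component G v" "L (component G v) = l" using F by blast
    then show "y \<in> {v \<in> verts G. L (component G v) = l}"
      using component_subset[of G v] component_eq[OF G v(2)] by auto
  next
    fix y assume "y \<in> {v \<in> verts G. L (component G v) = l}"
    then show "y \<in> \<Union>F" using component_self[of y G] by (auto simp: F_def)
  qed
  have "m * card F = card (\<Union>F)"
  proof (rule card_partition)
    show "finite F" using fin by (simp add: F_def)
    show "finite (\<Union>F)" using fin by (simp add: Un)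
    show "card A = m" if "A \<in> F" for A using F[OF that] m by blast
    show "A \<inter> B = {}" if "A \<in> F" "B \<in> F" "A \<noteq> B" for A B
      using F[OF that(1)] F[OF that(2)] that(3) component_eq[OF G] by blast
  qed
  then show ?thesis unfolding Un by (simp add: F_def)
qed

context wl_pair
begin

lemma connected_peq:
  assumes "peq x x x' x'"
  shows "(\<forall>u\<in>V. \<forall>w\<in>V. reach G {} u w) \<longleftrightarrow> (\<forall>u\<in>V'. \<forall>w\<in>V'. reach G' {} u w)"
proof -
  \<comment> \<open>Connectedness is tested from the single vertex \<open>y\<close>, which leaves
    one quantifier for \<open>peq_ex\<close>.\<close>
  have *: "(\<forall>u\<in>verts H. \<forall>w\<in>verts H. reach H {} u w) \<longleftrightarrow> \<not> (\<exists>w\<in>verts H. \<not> reach H {} y w)"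
    if "is_graph H" "y \<in> verts H" for H y
    using that(2) reach_sym[OF that(1)] reach_trans[of H "{}"] by blast
  have "(\<exists>w\<in>V. \<not> reach G {} x w) \<longleftrightarrow> (\<exists>w\<in>V'. \<not> reach G' {} x' w)"
    by (rule peq_ex[OF assms]) (simp add: reach_peq)
  then show ?thesis
    using peq_mem[OF assms] by (simp only: *[OF G, of x] *[OF G', of x'])
qed

lemma cut_exists_peq:
  assumes "peq x x x' x'"
  shows "(\<exists>s. cut G s) \<longleftrightarrow> (\<exists>s. cut G' s)"
proof -
  have "(\<exists>s\<in>V. cut G s) \<longleftrightarrow> (\<exists>s\<in>V'. cut G' s)"
    by (rule peq_ex[OF assms]) (rule cut_peq, rule peq_proj)
  moreover have "(\<exists>s. cut H s) \<longleftrightarrow> (\<exists>s\<in>verts H. cut H s)" for H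
    unfolding cut_def by blast
  ultimately show ?thesis by simp
qed

lemma card_verts_peq: "peq u v u' v' \<Longrightarrow> card V = card V'"
  using peq_step bij_betw_same_card by metis

end

context wl_pair_step
begin

lemma piece_iso_component:
  assumes "\<not> (\<forall>u\<in>V. \<forall>w\<in>V. reach G {} u w)" "peq x x x' x'"
  shows "\<exists>f. piece_iso (component G x) (component G' x') f"
proof (rule piece_iso_exists[OF _ _ reach_peq _ _ assms(2)])
  have mem: "x \<in> V" "x' \<in> V'" using peq_mem[OF assms(2)] by auto
  have "component G x \<noteq> V"
  proof
    assume "component G x = V"
    then have "reach G {} x u" if "u \<in> V" for u using that by (auto simp: component_def)
    then show False using assms(1) reach_sym[OF G] reach_trans[of G "{}"] by blast
  qed
  then show "component G x \<subset> V" using component_subset[of G x] by blast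
  show "component G' x' \<subseteq> V'" by (rule component_subset)
  show "x \<in> component G x" "x' \<in> component G' x'" using mem by (auto intro: component_self)
  have *: "z \<in> component H w \<longleftrightarrow> reach H {} y z" if "is_graph H" "y \<in> component H w" for H w y z
    using component_eq[OF that] by (auto simp: component_def)
  show "z \<in> component G x \<longleftrightarrow> reach G {} y z" if "y \<in> component G x" for y z using *[OF G that] .
  show "z \<in> component G' x' \<longleftrightarrow> reach G' {} y z" if "y \<in> component G' x'" for y z using *[OF G' that] .
qed

text \<open>Components are labelled by the set of vertex types they contain. Equal labels give
  isomorphic components, each label occurs equally often in both graphs, and the matched
  isomorphisms are glued.\<close>

lemma piece_iso_disconnected:
  assumes dis: "\<not> (\<forall>u\<in>V. \<forall>w\<in>V. reach G {} u w)" and x: "peq x x x' x'"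
  shows "\<exists>f. piece_iso V V' f"
proof -
  define L where "L = (\<lambda>A. (\<lambda>y. wl_type k G c (pair_tuple k y y)) ` A)"
  define L' where "L' = (\<lambda>A. (\<lambda>y. wl_type k G' c' (pair_tuple k y y)) ` A)"
  have L_eq: "L A = L' A'" "card A = card A'" if "piece_iso A A' f" for A A' f
  proof -
    have *: "bij_betw f A A'" "\<And>y. y \<in> A \<Longrightarrow> peq y y (f y) (f y)"
      using that by (auto simp: piece_iso_def)
    show "card A = card A'" using *(1) by (rule bij_betw_same_card)
    have "L A = L' (f ` A)"
      unfolding L_def L'_def image_image using *(2) by (intro image_cong) (auto simp: peq_def)
    then show "L A = L' A'" using bij_betw_imp_surj_on[OF *(1)] by simp
  qed
  have label: "\<exists>f. piece_iso (component G y) (component G' y') f"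
    if "y \<in> V" "y' \<in> V'" "L (component G y) = L' (component G' y')" for y y'
  proof -
    \<comment> \<open>Equal labels provide a vertex \<open>z'\<close> of the other component with
      the type of \<open>y\<close>, to which \<open>piece_iso_component\<close> applies.\<close>
    have "wl_type k G c (pair_tuple k y y) \<in> L' (component G' y')"
      using that(3) component_self[OF that(1)] unfolding L_def by blast
    then obtain z' where z': "z' \<in> component G' y'"
      "wl_type k G c (pair_tuple k y y) = wl_type k G' c' (pair_tuple k z' z')"
      unfolding L'_def by blast
    then have "peq y y z' z'" using that component_subset[of G' y'] by (auto simp: peq_def)
    then show ?thesis using piece_iso_component[OF dis] component_eq[OF G' z'(1)] by metis
  qed
  \<comment> \<open>This bijection may scatter components, but it preserves the label of the
    component of each vertex; that suffices for counting.\<close>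
  obtain \<beta> where \<beta>: "bij_betw \<beta> V V'" "\<And>w. w \<in> V \<Longrightarrow> peq w w (\<beta> w) (\<beta> w)"
    using peq_step[OF x] peq_proj(3) by metis
  have L\<beta>: "L' (component G' (\<beta> v)) = L (component G v)" if "v \<in> V" for v
    using piece_iso_component[OF dis \<beta>(2)[OF that]] L_eq(1) by metis
  have \<beta>V: "\<beta> v \<in> V'" if "v \<in> V" for v using \<beta>(1) that by (auto dest: bij_betwE)
  have card_eq: "card {A \<in> component G ` V. L A = l} = card {A \<in> component G' ` V'. L' A = l}" for l
  proof (cases "\<exists>v\<in>V. L (component G v) = l")
    case True
    then obtain v where v: "v \<in> V" "L (component G v) = l" by blast
    define m where "m = card (component G v)"
    have m': "card (component G' y') = m" if "y' \<in> V'" "L' (component G' y') = l" for y'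
      using label[OF v(1) that(1)] L_eq(2) that(2) v(2) unfolding m_def by metis
    \<comment> \<open>\<open>label\<close> compares only across the two graphs, so two components of
      \<open>G\<close> are compared through the component of \<open>\<beta> v\<close>.\<close>
    have m: "card (component G y) = m" if "y \<in> V" "L (component G y) = l" for y
    proof -
      have "L' (component G' (\<beta> v)) = l" using L\<beta> v by simp
      then show ?thesis
        using label[OF that(1) \<beta>V[OF v(1)]] L_eq(2) that(2) m'[OF \<beta>V[OF v(1)]] by metis
    qed
    have "bij_betw \<beta> {v \<in> V. L (component G v) = l} {v \<in> V'. L' (component G' v) = l}"
      by (rule bij_betw_Collect[OF \<beta>(1)]) (simp add: L\<beta>)
    then have "card {v \<in> V. L (component G v) = l} = card {v \<in> V'. L' (component G' v) = l}"
      by (rule bij_betw_same_card)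
    then have "m * card {A \<in> component G ` V. L A = l} = m * card {A \<in> component G' ` V'. L' A = l}"
      using card_fiber_of_component_label[of G L l m, OF G m]
        card_fiber_of_component_label[of G' L' l m, OF G' m'] by simp
    moreover have "m \<noteq> 0"
      using component_self[OF v(1)] finite_subset[OF component_subset fin(1)] by (auto simp: m_def card_eq_0_iff)
    ultimately show ?thesis by simp
  next
    case False
    have "L' (component G' v') \<noteq> l" if "v' \<in> V'" for v'
    proof -
      have "v' \<in> \<beta> ` V" using that bij_betw_imp_surj_on[OF \<beta>(1)] by simp
      then obtain v where "v \<in> V" "v' = \<beta> v" by (rule imageE)
      then show ?thesis using False L\<beta>[of v] by auto
    qed
    then have "{A \<in> component G' ` V'. L' A = l} = {}" by blast
    moreover have "{A \<in> component G ` V. L A = l} = {}" using False by blast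
    ultimately show ?thesis by (simp only: card.empty)
  qed
  obtain \<sigma> where \<sigma>: "bij_betw \<sigma> (component G ` V) (component G' ` V')"
    "\<And>A. A \<in> component G ` V \<Longrightarrow> L' (\<sigma> A) = L A"
    using bij_betw_if_card_fibers_eq[OF finite_imageI[OF fin(1)] finite_imageI[OF fin(2)] card_eq]
    by blast
  have \<sigma>_img: "\<exists>v'\<in>V'. \<sigma> A = component G' v'" if "A \<in> component G ` V" for A
    using bij_betwE[OF \<sigma>(1)] that by blast
  have "\<exists>h. \<forall>A\<in>component G ` V. piece_iso A (\<sigma> A) (h A)"
  proof (intro bchoice ballI)
    fix A assume A: "A \<in> component G ` V"
    then show "\<exists>f. piece_iso A (\<sigma> A) f"
      using label \<sigma>(2)[OF A] \<sigma>_img[OF A] by auto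
  qed
  then obtain h where h: "\<And>A. A \<in> component G ` V \<Longrightarrow> piece_iso A (\<sigma> A) (h A)" by blast
  \<comment> \<open>Maps a component of \<open>G'\<close> to its partner, so that vertices of both
    graphs are labelled by components of \<open>G\<close> for the gluing.\<close>
  define \<tau> where "\<tau> = inv_into (component G ` V) \<sigma>"
  have \<tau>: "\<tau> (component G' y) = A \<longleftrightarrow> y \<in> \<sigma> A" if ty: "A \<in> component G ` V" "y \<in> V'" for A y
  proof -
    obtain v' where v': "v' \<in> V'" "\<sigma> A = component G' v'" using \<sigma>_img[OF ty(1)] by blast
    have "\<tau> (component G' y) = A \<longleftrightarrow> component G' y = \<sigma> A"
      using ty \<sigma>(1) unfolding \<tau>_def
      by (metis bij_betw_inv_into_left bij_betw_inv_into_right imageI)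
    also have "\<dots> \<longleftrightarrow> y \<in> \<sigma> A"
      using component_self[OF ty(2)] component_eq[OF G', of y v'] v'(2) by auto
    finally show ?thesis .
  qed
  have \<tau>_mem: "\<tau> (component G' y) \<in> component G ` V" if "y \<in> V'" for y
    unfolding \<tau>_def using that bij_betw_imp_surj_on[OF \<sigma>(1)] by (intro inv_into_into) simp
  define F where "F = (\<lambda>v. h (component G v) v)"
  have "bij_betw (h A) {a \<in> V. component G a = A} {b \<in> V'. \<tau> (component G' b) = A}" for A
  proof (cases "A \<in> component G ` V")
    case True
    then obtain v where v: "v \<in> V" "A = component G v" by blast
    have "{a \<in> V. component G a = A} = A"
      using component_mem_iff[OF G, of _ v] v(2) by blast
    moreover have "{b \<in> V'. \<tau> (component G' b) = A} = \<sigma> A"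
      using \<tau>[OF True] \<sigma>_img[OF True] component_subset[of G'] by blast
    ultimately show ?thesis using h[OF True] by (simp add: piece_iso_def)
  next
    case False
    then have "{a \<in> V. component G a = A} = {}" "{b \<in> V'. \<tau> (component G' b) = A} = {}"
      using \<tau>_mem by auto
    then show ?thesis by (simp only: bij_betw_def inj_on_empty image_empty simp_thms)
  qed
  then have "bij_betw F V V'" unfolding F_def by (rule glue_bij_betw)
  moreover have hv: "piece_iso (component G v) (\<sigma> (component G v)) (h (component G v))" if "v \<in> V" for v
    using h that by blast
  then have Fpeq: "peq v v (F v) (F v)" "F v \<in> \<sigma> (component G v)" if "v \<in> V" for v
    using hv[OF that] component_self[OF that] by (auto simp: F_def piece_iso_def dest: bij_betwE)
  moreover have "adj G y z \<longleftrightarrow> adj G' (F y) (F z)" if yz: "y \<in> V" "z \<in> V" for y z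
  proof (cases "component G y = component G z")
    case True
    then show ?thesis
      using hv[OF yz(1)] component_self[OF yz(1)] component_self[OF yz(2)] by (simp add: F_def piece_iso_def)
  next
    case False
    have "component G' (F y) \<noteq> component G' (F z)"
      using False Fpeq(2)[OF yz(1)] Fpeq(2)[OF yz(2)] \<tau>[of "component G y" "F y"] \<tau>[of "component G z" "F z"]
        peq_mem[OF Fpeq(1)[OF yz(1)]] peq_mem[OF Fpeq(1)[OF yz(2)]] yz by auto
    then show ?thesis using False component_adj[OF G] component_adj[OF G'] by blast
  qed
  ultimately show ?thesis by (auto simp: piece_iso_def)
qed

end

section \<open>Connected graphs with a cut vertex\<close>

context wl_pair_step
begin

text \<open>\<open>T\<close> collects the hanging vertices, \<open>a\<close> sends each to its
  attachment vertex, and \<open>R s\<close> is what hangs at \<open>s\<close>. The rest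
  \<open>V - T\<close> and all sets \<open>R s\<close> are smaller pieces; edges between pieces only
  join a hanging vertex to its attachment vertex.\<close>

lemma piece_iso_cut:
  assumes conn: "\<forall>u\<in>V. \<forall>w\<in>V. reach G {} u w" and cut: "cut G s\<^sub>0" and x\<^sub>0: "peq x\<^sub>0 x\<^sub>0 x\<^sub>0' x\<^sub>0'"
  shows "\<exists>f. piece_iso V V' f"
proof -
  have conn': "\<forall>u\<in>V'. \<forall>w\<in>V'. reach G' {} u w" using connected_peq[OF x\<^sub>0] conn by blast
  define T where "T = {w \<in> V. \<exists>s\<in>V. hang G w s}"
  define T' where "T' = {w \<in> V'. \<exists>s\<in>V'. hang G' w s}"
  define a where "a = (\<lambda>w. THE s. hang G w s)"
  define a' where "a' = (\<lambda>w. THE s. hang G' w s)"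
  define R where "R = (\<lambda>s. {w \<in> V. hang G w s})"
  define R' where "R' = (\<lambda>s. {w \<in> V'. hang G' w s})"
  have hang_mem: "w \<in> V \<and> s \<in> V" if "hang G w s" for w s
    using that by (auto simp: hang_def cut_def)
  have hang_mem': "w \<in> V' \<and> s \<in> V'" if "hang G' w s" for w s
    using that by (auto simp: hang_def cut_def)
  have a: "a w = s" if "hang G w s" for w s
    unfolding a_def using that hang_unique[OF G conn] by blast
  have a': "a' w = s" if "hang G' w s" for w s
    unfolding a'_def using that hang_unique[OF G' conn'] by blast
  have aT: "hang G w (a w)" if "w \<in> T" for w using that a by (auto simp: T_def)
  have aT': "hang G' w (a' w)" if "w \<in> T'" for w using that a' by (auto simp: T'_def)
  have aS: "a w \<in> V - T" if "w \<in> T" for w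
    using aT[OF that] hang_mem[OF aT[OF that]] hang_not_hang[OF aT[OF that]] by (auto simp: T_def)
  have aS': "a' w \<in> V' - T'" if "w \<in> T'" for w
    using aT'[OF that] hang_mem'[OF aT'[OF that]] hang_not_hang[OF aT'[OF that]] by (auto simp: T'_def)
  have T_peq: "y \<in> T \<longleftrightarrow> y' \<in> T'" if "peq y y y' y'" for y y'
    using hangs_somewhere_peq[OF that] peq_mem[OF that] by (simp add: T_def T'_def)
  obtain w\<^sub>0 where w\<^sub>0: "w\<^sub>0 \<in> T"
    using hang_exists[OF G conn cut] hang_mem unfolding T_def by blast
  \<comment> \<open>The rest is a proper subset since \<open>w\<^sub>0\<close> hangs, and nonempty
    since it contains \<open>a w\<^sub>0\<close>.\<close>
  obtain g where g: "piece_iso (V - T) (V' - T') g"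
  proof -
    have s: "a w\<^sub>0 \<in> V - T" using aS[OF w\<^sub>0] .
    obtain s' where s': "peq (a w\<^sub>0) (a w\<^sub>0) s' s'"
      using peq_step[OF x\<^sub>0] peq_proj(3) s by (metis DiffD1)
    have "\<exists>g. piece_iso (V - T) (V' - T') g"
    proof (rule piece_iso_exists[where P = "\<lambda>x y. y \<notin> T" and P' = "\<lambda>x y. y \<notin> T'", OF _ _ _ _ _ s' s])
      show "V - T \<subset> V" using w\<^sub>0 by (auto simp: T_def)
      show "y \<notin> T \<longleftrightarrow> y' \<notin> T'" if "peq x y x' y'" for x y x' y'
        using T_peq[OF peq_proj(3)[OF that]] by simp
      show "s' \<in> V' - T'" using s T_peq[OF s'] peq_mem[OF s'] by simp
    qed auto
    then show ?thesis using that by blast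
  qed
  have g_bij: "bij_betw g (V - T) (V' - T')" and
    g_adj: "\<And>x y. x \<in> V - T \<Longrightarrow> y \<in> V - T \<Longrightarrow> adj G x y \<longleftrightarrow> adj G' (g x) (g y)" and
    g_peq: "\<And>x. x \<in> V - T \<Longrightarrow> peq x x (g x) (g x)"
    using g by (auto simp: piece_iso_def)
  \<comment> \<open>\<open>s\<close> and \<open>g s\<close> have the same type, so vertices hang at
    both or at neither. Belonging to such a piece is recognised by hanging at a common vertex; the
    empty piece is separate, as the induction needs a vertex.\<close>
  have piece_R: "\<exists>h. piece_iso (R s) (R' (g s)) h" if s: "s \<in> V - T" for s
  proof (cases "R s = {}")
    case True
    have "(\<exists>w\<in>V. hang G w s) \<longleftrightarrow> (\<exists>w\<in>V'. hang G' w (g s))"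
      by (rule peq_ex[OF g_peq[OF s]]) (rule hang_peq)
    then have "R' (g s) = {}" using True by (auto simp: R_def R'_def)
    with True show ?thesis by (auto simp: piece_iso_def)
  next
    case False
    then obtain w where w: "w \<in> V" "hang G w s" by (auto simp: R_def)
    obtain w' where w': "peq w s w' (g s)"
      using peq_step[OF g_peq[OF s]] w(1) by metis
    have "hang G' w' (g s)" using hang_peq[OF w'] w by simp
    have R_iff: "y \<in> R s \<longleftrightarrow> (\<exists>t\<in>V. hang G z t \<and> hang G y t)" if "z \<in> R s" "y \<in> V" for z y
      using that a[of z] s by (auto simp: R_def)
    have R'_iff: "y \<in> R' (g s) \<longleftrightarrow> (\<exists>t\<in>V'. hang G' z t \<and> hang G' y t)"
      if "z \<in> R' (g s)" "y \<in> V'" for z y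
    proof -
      have "hang G' z (g s)" using that(1) by (simp add: R'_def)
      then have "hang G' z t \<longleftrightarrow> t = g s" for t using a' by blast
      then show ?thesis using that(2) peq_mem[OF g_peq[OF s]] by (simp add: R'_def)
    qed
    show ?thesis
    proof (rule piece_iso_exists[where P = "\<lambda>x y. \<exists>t\<in>V. hang G x t \<and> hang G y t"
          and P' = "\<lambda>x y. \<exists>t\<in>V'. hang G' x t \<and> hang G' y t",
          OF _ _ hang_together_peq R_iff R'_iff peq_proj(2)[OF w']])
      show "R s \<subset> V" using s by (auto simp: R_def hang_def)
      show "R' (g s) \<subseteq> V'" by (auto simp: R'_def)
      show "w \<in> R s" "w' \<in> R' (g s)"
        using w peq_mem[OF w'] \<open>hang G' w' (g s)\<close> by (auto simp: R_def R'_def)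
    qed
  qed
  have "\<exists>h. \<forall>s\<in>V - T. piece_iso (R s) (R' (g s)) (h s)"
    by (intro bchoice ballI) (rule piece_R)
  then obtain h where h: "\<And>s. s \<in> V - T \<Longrightarrow> piece_iso (R s) (R' (g s)) (h s)" by blast
  define F where "F = (\<lambda>w. if w \<in> T then h (a w) w else g w)"
  have F_T: "F w \<in> R' (g (a w))" "peq w w (F w) (F w)" "F w \<in> T'" "a' (F w) = g (a w)"
    if "w \<in> T" for w
  proof -
    have "w \<in> R (a w)" using aT[OF that] hang_mem by (auto simp: R_def)
    then show *: "F w \<in> R' (g (a w))" "peq w w (F w) (F w)"
      using h[OF aS[OF that]] that by (auto simp: piece_iso_def F_def dest: bij_betwE)
    then show "F w \<in> T'" "a' (F w) = g (a w)"
      using a' hang_mem' by (auto simp: R'_def T'_def)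
  qed
  have F_S: "F w = g w" "peq w w (F w) (F w)" "F w \<in> V' - T'" if "w \<in> V - T" for w
    using that g_peq[OF that] bij_betwE[OF g_bij] by (auto simp: F_def)
  \<comment> \<open>The label \<open>None\<close> marks the rest and \<open>Some s\<close> what
    hangs at \<open>s\<close>. In \<open>G'\<close> the attachment vertex is pulled back along
    \<open>g\<close>, so that both graphs use the same labels.\<close>
  define p where "p = (\<lambda>w. if w \<in> T then Some (a w) else None)"
  define p' where "p' = (\<lambda>w. if w \<in> T' then Some (inv_into (V - T) g (a' w)) else None)"
  define H where "H = (\<lambda>i. case i of None \<Rightarrow> g | Some s \<Rightarrow> h s)"
  have "bij_betw (H i) {w \<in> V. p w = i} {w \<in> V'. p' w = i}" for i
  proof (cases i)
    case None
    then have "{w \<in> V. p w = i} = V - T" "{w \<in> V'. p' w = i} = V' - T'"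
      by (auto simp: p_def p'_def)
    then show ?thesis using g_bij None by (simp add: H_def)
  next
    case (Some s)
    show ?thesis
    proof (cases "s \<in> V - T")
      case True
      have "{w \<in> V. p w = i} = R s"
        using Some a aT True by (auto simp: p_def R_def T_def split: if_splits)
      moreover have "inv_into (V - T) g (a' w) = s \<longleftrightarrow> hang G' w (g s)" if "w \<in> T'" for w
      proof -
        have "inv_into (V - T) g (a' w) = s \<longleftrightarrow> a' w = g s"
          using bij_betw_inv_into_left[OF g_bij True] bij_betw_inv_into_right[OF g_bij aS'[OF that]]
          by auto
        also have "\<dots> \<longleftrightarrow> hang G' w (g s)" using a'[of w "g s"] aT'[OF that] by auto
        finally show ?thesis .
      qed
      then have "{w \<in> V'. p' w = i} = R' (g s)"
        using Some peq_mem[OF g_peq[OF True]] by (auto simp: p'_def R'_def T'_def split: if_splits)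
      ultimately show ?thesis using h[OF True] Some by (simp add: H_def piece_iso_def)
    next
      case False
      have "{w \<in> V. p w = i} = {}" using Some aS False by (auto simp: p_def split: if_splits)
      moreover have inv_mem: "inv_into (V - T) g (a' w) \<in> V - T" if "w \<in> T'" for w
        using aS'[OF that] bij_betw_imp_surj_on[OF g_bij] by (intro inv_into_into) simp
      have "{w \<in> V'. p' w = i} = {}" using Some False inv_mem by (auto simp: p'_def split: if_splits)
      ultimately show ?thesis by (simp only: bij_betw_def inj_on_empty image_empty simp_thms)
    qed
  qed
  then have "bij_betw (\<lambda>w. H (p w) w) V V'" by (rule glue_bij_betw)
  moreover have "(\<lambda>w. H (p w) w) = F" by (auto simp: H_def p_def F_def)
  ultimately have F_bij: "bij_betw F V V'" by simp
  have F_peq: "peq w w (F w) (F w)" if "w \<in> V" for w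
    using F_T(2) F_S(2) that by blast
  have adj_T: "adj G w y \<longleftrightarrow> y = a w \<and> adj G w (a w)" if "w \<in> T" "y \<notin> T" for w y
    using hang_adj[OF G aT[OF that(1)], of y] that(2) hang_mem by (auto simp: T_def)
  have adj_T': "adj G' w y \<longleftrightarrow> y = a' w \<and> adj G' w (a' w)" if "w \<in> T'" "y \<notin> T'" for w y
    using hang_adj[OF G' aT'[OF that(1)], of y] that(2) hang_mem' by (auto simp: T'_def)
  \<comment> \<open>Whether \<open>y\<close> is the attachment vertex is preserved because
    \<open>g\<close> is injective; whether \<open>w\<close> is adjacent to its attachment vertex can
    be read off the type of \<open>w\<close>.\<close>
  have adj_TS: "adj G w y \<longleftrightarrow> adj G' (F w) (F y)" if w: "w \<in> T" and y: "y \<in> V - T" for w y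
  proof -
    have "y = a w \<longleftrightarrow> g y = g (a w)"
      using inj_on_eq_iff[OF bij_betw_imp_inj_on[OF g_bij] y aS[OF w]] by simp
    then have "y = a w \<longleftrightarrow> F y = a' (F w)" using F_T(4)[OF w] F_S(1)[OF y] by simp
    moreover have "adj G w (a w) \<longleftrightarrow> (\<exists>s\<in>V. hang G w s \<and> adj G w s)"
      using aT[OF w] a hang_mem by blast
    moreover have "adj G' (F w) (a' (F w)) \<longleftrightarrow> (\<exists>s\<in>V'. hang G' (F w) s \<and> adj G' (F w) s)"
      using aT'[OF F_T(3)[OF w]] a' hang_mem' by blast
    moreover note adj_attachment_peq[OF F_T(2)[OF w]]
    moreover have "y \<notin> T" "F y \<notin> T'" using y F_S(3)[OF y] by auto
    ultimately show ?thesis using adj_T[OF w] adj_T'[OF F_T(3)[OF w]] by simp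
  qed
  have adj_TT: "adj G w y \<longleftrightarrow> adj G' (F w) (F y)" if w: "w \<in> T" and y: "y \<in> T" for w y
  proof (cases "a w = a y")
    case True
    have "w \<in> R (a w)" "y \<in> R (a w)"
      using aT[OF w] aT[OF y] True hang_mem by (auto simp: R_def)
    then show ?thesis using h[OF aS[OF w]] w y True by (simp add: piece_iso_def F_def)
  next
    case False
    then have ne: "a' (F w) \<noteq> a' (F y)"
      using inj_on_eq_iff[OF bij_betw_imp_inj_on[OF g_bij] aS[OF w] aS[OF y]] F_T(4)[OF w] F_T(4)[OF y]
      by simp
    have "\<not> adj G w y"
    proof
      assume "adj G w y"
      moreover have "y \<noteq> a w" using aS[OF w] y by blast
      ultimately have "hang G y (a w)" by (rule hang_adj[OF G aT[OF w]])
      then show False using a False by simp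
    qed
    moreover have "\<not> adj G' (F w) (F y)"
    proof
      assume "adj G' (F w) (F y)"
      moreover have "F y \<noteq> a' (F w)" using aS'[OF F_T(3)[OF w]] F_T(3)[OF y] by (metis DiffD2)
      ultimately have "hang G' (F y) (a' (F w))" by (rule hang_adj[OF G' aT'[OF F_T(3)[OF w]]])
      then show False using a' ne by simp
    qed
    ultimately show ?thesis by simp
  qed
  have adj_commute: "adj G w y = adj G y w" "adj G' w y = adj G' y w" for w y
    using adj_sym G G' by blast+
  have "adj G w y \<longleftrightarrow> adj G' (F w) (F y)" if "w \<in> V" "y \<in> V" for w y
  proof (cases "w \<in> T")
    case True
    then show ?thesis using adj_TS adj_TT that(2) by (cases "y \<in> T") auto
  next
    case False
    then show ?thesis
      using adj_TS[of y w] g_adj[of w y] F_S(1) that adj_commute by (cases "y \<in> T") auto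
  qed
  with F_bij F_peq show ?thesis by (auto simp: piece_iso_def)
qed

end

section \<open>Graphs with at most two vertices\<close>

context wl_pair
begin

text \<open>A bijection answering from the pair \<open>x\<close>, \<open>x\<close> sends
  \<open>x\<close> to \<open>x'\<close>, so it preserves the type of the only pair of distinct
  vertices, if there is one.\<close>

lemma piece_iso_small:
  assumes "card V \<le> 2" "peq x x x' x'"
  shows "\<exists>f. piece_iso V V' f"
proof -
  obtain y where y: "V = {x, y}"
  proof (cases "V = {x}")
    case False
    then obtain y where "y \<in> V" "y \<noteq> x" using peq_mem[OF assms(2)] by blast
    then have "card {x, y} = 2" "{x, y} \<subseteq> V" using peq_mem[OF assms(2)] by auto
    then have "{x, y} = V" using assms(1) by (intro card_seteq[OF fin(1)]) simp_all
    with that show ?thesis by blast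
  qed (use that in auto)
  obtain \<beta> where \<beta>: "bij_betw \<beta> V V'" "\<And>w. w \<in> V \<Longrightarrow> peq x w x' (\<beta> w)"
    using peq_step[OF assms(2)] by metis
  have pw: "peq w w (\<beta> w) (\<beta> w)" if "w \<in> V" for w using peq_proj(3)[OF \<beta>(2)[OF that]] .
  have "\<beta> x = x'" using peq_init(2)[OF \<beta>(2), of x] y by simp
  then have xy: "peq x y (\<beta> x) (\<beta> y)" using \<beta>(2)[of y] y by simp
  have "adj G w z \<longleftrightarrow> adj G' (\<beta> w) (\<beta> z)" if "w \<in> V" "z \<in> V" for w z
  proof (cases "w = z")
    case True
    then show ?thesis using peq_init(3)[OF pw[OF that(1)]] by simp
  next
    case False
    then have "w = x \<and> z = y \<or> w = y \<and> z = x" using that by (auto simp: y)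
    then show ?thesis using peq_init(3)[OF xy] peq_init(3)[OF peq_proj(1)[OF xy]] by auto
  qed
  with \<beta>(1) pw show ?thesis by (auto simp: piece_iso_def)
qed

lemma iso_col_if_piece_iso: "piece_iso V V' f \<Longrightarrow> iso_col G c G' c'"
  using peq_init(1) unfolding piece_iso_def iso_col_def by metis

end

text \<open>Strong induction with graphs and colourings arbitrary, because pieces are recoloured by
  their types. One common vertex type serves as the hypothesis, since this is what pieces
  inherit.\<close>

lemma iso_col_if_type_eq:
  assumes \<G>: "hereditary_class \<G>" and k: "k \<ge> 2"
    and two_connected: "\<forall>H\<in>\<G>. \<forall>H'\<in>\<G>. \<forall>c c'. k_connected 2 H \<and> k_connected 2 H' \<and>
      \<not> iso_col H c H' c' \<longrightarrow> wl_distinguishes k H c H' c'"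
    and "G \<in> \<G>" "G' \<in> \<G>" "x \<in> verts G" "x' \<in> verts G'"
    and "wl_type k G c (pair_tuple k x x) = wl_type k G' c' (pair_tuple k x' x')"
  shows "iso_col G c G' c'"
  using assms(4-)
proof (induction "card (verts G)" arbitrary: G G' c c' x x' rule: less_induct)
  case less
  have graphs: "is_graph G" "is_graph G'"
    using \<G> less.prems(1,2) unfolding hereditary_class_def by blast+
  have induced: "induced H U \<in> \<G>" if "H \<in> \<G>" "U \<subseteq> verts H" for H U
    using \<G> that unfolding hereditary_class_def by blast
  interpret wl_pair_step k G G' c c'
  proof
    fix U U' d d' y y'
    assume U: "U \<subset> verts G" "U' \<subseteq> verts G'" "y \<in> U" "y' \<in> U'"
      "wl_type k (induced G U) d (pair_tuple k y y) = wl_type k (induced G' U') d' (pair_tuple k y' y')"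
    have "card U < card (verts G)"
      using U(1) graphs(1) by (intro psubset_card_mono) (simp_all add: is_graph_def)
    then show "iso_col (induced G U) d (induced G' U') d'"
      using U induced[OF less.prems(1)] induced[OF less.prems(2)]
      by (intro less.hyps[of "induced G U" "induced G' U'" y y' d d']) auto
  qed (use graphs k in auto)
  have x: "peq x x x' x'" using less.prems by (simp add: peq_def)
  consider "\<not> (\<forall>u\<in>V. \<forall>w\<in>V. reach G {} u w)" | "card V \<le> 2"
    | "\<forall>u\<in>V. \<forall>w\<in>V. reach G {} u w" "\<exists>s. cut G s"
    | "\<forall>u\<in>V. \<forall>w\<in>V. reach G {} u w" "\<not> (\<exists>s. cut G s)" "card V > 2"
    by fastforce
  then show ?case
  proof cases
    case 1
    then show ?thesis using piece_iso_disconnected[OF _ x] iso_col_if_piece_iso by blast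
  next
    case 2
    then show ?thesis using piece_iso_small[OF _ x] iso_col_if_piece_iso by blast
  next
    case 3
    then show ?thesis using piece_iso_cut[OF _ _ x] iso_col_if_piece_iso by blast
  next
    case 4
    \<comment> \<open>Types determine connectedness, cut vertices and the number of vertices, so
      both graphs are 2-connected. The assumption would distinguish them if they were not
      isomorphic, but a common type excludes that.\<close>
    have "k_connected 2 G" using 4 by (simp add: two_connected_iff[OF graphs(1)])
    moreover have "k_connected 2 G'"
      using 4 connected_peq[OF x] cut_exists_peq[OF x] card_verts_peq[OF x]
      by (simp add: two_connected_iff[OF graphs(2)])
    ultimately show ?thesis
      using two_connected less.prems(1,2) teq_not_distinguishes[OF peq_teq[OF x]] by blast
  qed
qed

theorem theorem5:
  fixes \<G> :: "graph set" and k :: nat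
  assumes "hereditary_class \<G>" and "k \<ge> 2"
    and "\<forall>H\<in>\<G>. \<forall>H'\<in>\<G>. \<forall>c c'. k_connected 2 H \<and> k_connected 2 H' \<and> \<not> iso_col H c H' c'
            \<longrightarrow> wl_distinguishes k H c H' c'"
  shows "\<forall>G\<in>\<G>. \<forall>G'\<in>\<G>. \<not> iso G G' \<longrightarrow> wl_distinguishes k G (\<lambda>_. 0) G' (\<lambda>_. 0)"
proof (intro ballI impI, rule ccontr)
  fix G G' assume mem: "G \<in> \<G>" "G' \<in> \<G>" and "\<not> iso G G'"
    and eq: "\<not> wl_distinguishes k G (\<lambda>_. 0) G' (\<lambda>_. 0)"
  interpret wl_pair k G G' "\<lambda>_. 0" "\<lambda>_. 0"
    using assms(1,2) mem by unfold_locales (auto simp: hereditary_class_def)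
  have "iso G G'"
  \<comment> \<open>Empty graphs have no vertex type to compare and are isomorphic outright.\<close>
  proof (cases "V = {} \<and> V' = {}")
    case True
    then show ?thesis by (simp add: iso_def iso_col_def bij_betw_def)
  next
    case False
    then obtain x x' where "peq x x x' x'" using not_distinguishes_peq[OF eq] by blast
    then show ?thesis
      unfolding iso_def using iso_col_if_type_eq[OF assms mem] by (auto simp: peq_def)
  qed
  with \<open>\<not> iso G G'\<close> show False by contradiction
qed

end
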